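(* Let $\varphi$ be a free holomorphic self-map of the ball $[B(\mathcal H)^n]_1$ such that $\varphi(0)=0$, and let $f\in H^2_{\bf ball}$. Then $f\circ\varphi\in H^2_{\bf ball}$ and $\|f\circ\varphi\|_2\le\|f\|_2$.
   Context: $n\ge1$; $\mathcal H$ is a separable infinite dimensional complex Hilbert space. $\mathbb F_n^+$ is the free semigroup with generators $g_1,\ldots,g_n$ and identity $g_0$; $|g_0|=0$, $|\alpha|=k$ if $\alpha=g_{i_1}\cdots g_{i_k}$; $X_\alpha:=X_{i_1}\cdots X_{i_k}$, $X_{g_0}:=I$. $[B(\mathcal H)^n]_1:=\{(X_1,\ldots,X_n)\in B(\mathcal H)^n:\ \|X_1X_1^*+\cdots+X_nX_n^*\|^{1/2}<1\}$. A free holomorphic function $f:[B(\mathcal H)^n]_1\to B(\mathcal H)$ is a map $f(X)=\sum_{k=0}^\infty\sum_{|\alpha|=k}a_\alpha X_\alpha$ (series over $k$ converging in operator norm) with $a_\alpha\in\mathbb C$ and $\limsup_{k\to\infty}(\sum_{|\alpha|=k}|a_\alpha|^2)^{1/2k}\le1$. A free holomorphic self-map $\varphi=(\varphi_1,\ldots,\varphi_n)$ of $[B(\mathcal H)^n]_1$ has each $\varphi_i$ free holomorphic and $\varphi(X)\in[B(\mathcal H)^n]_1$ for all $X\in[B(\mathcal H)^n]_1$. With $\varphi_\alpha:=\varphi_{i_1}\cdots\varphi_{i_k}$, the composition is the free holomorphic function $(f\circ\varphi)(X)=\sum_{k=0}^\infty\sum_{|\alpha|=k}a_\alpha\varphi_\alpha(X)$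 (convergence in operator norm). $H^2_{\bf ball}$ is the Hilbert space of free holomorphic functions $f=\sum_\alpha a_\alpha X_\alpha$ on $[B(\mathcal H)^n]_1$ with $\|f\|_2^2:=\sum_{\alpha\in\mathbb F_n^+}|a_\alpha|^2<\infty$. *)

theory Defs
  imports "HOL-Analysis.Analysis"
begin

text \<open>Complex Hilbert spaces. The inner product is linear in the first argument; the underlying
  real Hilbert space carries its real part, so the norm is the Hilbert space norm.\<close>

class chilbert_space = real_inner + complete_space +
  fixes scaleC :: "complex \<Rightarrow> 'a \<Rightarrow> 'a" (infixr "*\<^sub>C" 75)
    and cinner :: "'a \<Rightarrow> 'a \<Rightarrow> complex"
  assumes scaleC_add_right: "c *\<^sub>C (x + y) = c *\<^sub>C x + c *\<^sub>C y"
    and scaleC_add_left: "(c + d) *\<^sub>C x = c *\<^sub>C x + d *\<^sub>C x"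
    and scaleC_scaleC: "c *\<^sub>C d *\<^sub>C x = (c * d) *\<^sub>C x"
    and scaleC_one: "1 *\<^sub>C x = x"
    and scaleR_scaleC: "r *\<^sub>R x = complex_of_real r *\<^sub>C x"
    and cinner_commute: "cinner x y = cnj (cinner y x)"
    and cinner_add_left: "cinner (x + y) z = cinner x z + cinner y z"
    and cinner_scaleC_left: "cinner (c *\<^sub>C x) y = c * cinner x y"
    and inner_eq_Re_cinner: "inner x y = Re (cinner x y)"
begin
subclass banach ..
end

lemma vector_space_scaleC: "vector_space (scaleC :: complex \<Rightarrow> 'h::chilbert_space \<Rightarrow> 'h)"
  by standard (simp_all add: scaleC_add_right scaleC_add_left scaleC_scaleC scaleC_one)

lemma norm_scaleC: "norm (c *\<^sub>C x) = cmod c * norm (x :: 'h::chilbert_space)"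
proof -
  have "cinner (c *\<^sub>C x) (c *\<^sub>C x) = c * cnj (cinner (c *\<^sub>C x) x)"
    by (metis cinner_commute cinner_scaleC_left)
  also have "\<dots> = complex_of_real ((cmod c)\<^sup>2) * cinner x x"
    by (metis cinner_commute cinner_scaleC_left complex_cnj_mult complex_norm_square mult.assoc)
  finally have "inner (c *\<^sub>C x) (c *\<^sub>C x) = (cmod c)\<^sup>2 * inner x x"
    by (simp add: inner_eq_Re_cinner)
  then show ?thesis
    by (simp add: norm_eq_sqrt_inner real_sqrt_mult)
qed

text \<open>The library type of bounded operators consists of the real-linear ones; \<open>B(H)\<close> is the
  subset of complex-linear operators, with the same operator norm.\<close>

definition BH :: "('h::chilbert_space \<Rightarrow>\<^sub>L 'h) set" where
  "BH = {T. \<forall>c x. blinfun_apply T (c *\<^sub>C x) = c *\<^sub>C blinfun_apply T x}"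

lift_definition scaleC_op :: "complex \<Rightarrow> ('h::chilbert_space \<Rightarrow>\<^sub>L 'h) \<Rightarrow> ('h \<Rightarrow>\<^sub>L 'h)"
  is "\<lambda>c T x. c *\<^sub>C T x"
proof -
  fix c :: complex and T :: "'h \<Rightarrow> 'h"
  assume "bounded_linear T"
  then interpret T: bounded_linear T .
  show "bounded_linear (\<lambda>x. c *\<^sub>C T x)"
  proof (rule bounded_linear_intro)
    show "c *\<^sub>C T (x + y) = c *\<^sub>C T x + c *\<^sub>C T y" for x y
      by (simp add: T.add scaleC_add_right)
    show "c *\<^sub>C T (r *\<^sub>R x) = r *\<^sub>R (c *\<^sub>C T x)" for r x
      unfolding T.scale unfolding scaleR_scaleC scaleC_scaleC by (simp add: mult.commute)
    show "norm (c *\<^sub>C T x) \<le> norm x * (cmod c * onorm T)" for x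
      using onorm[OF \<open>bounded_linear T\<close>, of x]
      by (metis mult.assoc mult.commute mult_left_mono norm_ge_zero norm_scaleC)
  qed
qed

text \<open>Hilbert space adjoint; it exists, uniquely, for every \<open>T\<close> in \<open>BH\<close>.\<close>

definition op_adj :: "('h::chilbert_space \<Rightarrow>\<^sub>L 'h) \<Rightarrow> ('h \<Rightarrow>\<^sub>L 'h)" where
  "op_adj T = (THE S. \<forall>x y. cinner (blinfun_apply T x) y = cinner x (blinfun_apply S y))"

text \<open>An \<open>n\<close>-tuple is a function on a finite index type \<open>'n\<close> with \<open>CARD('n) = n\<close>; the free semigroup
  on \<open>n\<close> generators is the type \<open>'n list\<close>, with the empty word as identity.\<close>

definition row_ball :: "('n::finite \<Rightarrow> ('h::chilbert_space \<Rightarrow>\<^sub>L 'h)) set" where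
  "row_ball = {X. (\<forall>i. X i \<in> BH) \<and> sqrt (norm (\<Sum>i\<in>UNIV. X i o\<^sub>L op_adj (X i))) < 1}"

definition op_word :: "('n \<Rightarrow> ('h::chilbert_space \<Rightarrow>\<^sub>L 'h)) \<Rightarrow> 'n list \<Rightarrow> ('h \<Rightarrow>\<^sub>L 'h)" where
  "op_word X \<alpha> = foldr (\<lambda>i T. X i o\<^sub>L T) \<alpha> id_blinfun"

text \<open>Functions on the ball are total functions whose values off \<open>row_ball\<close> are irrelevant.
  In the \<open>limsup\<close>, the term with \<open>k = 0\<close> has a junk exponent, which does not affect the limit.\<close>

definition has_free_series ::
  "(('n::finite \<Rightarrow> ('h::chilbert_space \<Rightarrow>\<^sub>L 'h)) \<Rightarrow> ('h \<Rightarrow>\<^sub>L 'h)) \<Rightarrow> ('n list \<Rightarrow> complex) \<Rightarrow> bool" where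
  "has_free_series f a \<longleftrightarrow>
     limsup (\<lambda>k. ereal ((\<Sum>\<alpha> | length \<alpha> = k. (cmod (a \<alpha>))\<^sup>2) powr (1 / (2 * real k)))) \<le> 1 \<and>
     (\<forall>X\<in>row_ball. (\<lambda>k. \<Sum>\<alpha> | length \<alpha> = k. scaleC_op (a \<alpha>) (op_word X \<alpha>)) sums f X)"

definition free_holomorphic ::
  "(('n::finite \<Rightarrow> ('h::chilbert_space \<Rightarrow>\<^sub>L 'h)) \<Rightarrow> ('h \<Rightarrow>\<^sub>L 'h)) \<Rightarrow> bool" where
  "free_holomorphic f \<longleftrightarrow> (\<exists>a. has_free_series f a)"

text \<open>The coefficients are determined by the function as soon as \<open>'h\<close> is infinite dimensional.\<close>

definition free_coeff ::
  "(('n::finite \<Rightarrow> ('h::chilbert_space \<Rightarrow>\<^sub>L 'h)) \<Rightarrow> ('h \<Rightarrow>\<^sub>L 'h)) \<Rightarrow> 'n list \<Rightarrow> complex" where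
  "free_coeff f = (THE a. has_free_series f a)"

definition free_self_map ::
  "(('n::finite \<Rightarrow> ('h::chilbert_space \<Rightarrow>\<^sub>L 'h)) \<Rightarrow> ('n \<Rightarrow> ('h \<Rightarrow>\<^sub>L 'h))) \<Rightarrow> bool" where
  "free_self_map \<phi> \<longleftrightarrow>
     (\<forall>i. free_holomorphic (\<lambda>X. \<phi> X i)) \<and> (\<forall>X\<in>row_ball. \<phi> X \<in> row_ball)"

definition H2_ball ::
  "(('n::finite \<Rightarrow> ('h::chilbert_space \<Rightarrow>\<^sub>L 'h)) \<Rightarrow> ('h \<Rightarrow>\<^sub>L 'h)) set" where
  "H2_ball = {f. free_holomorphic f \<and> (\<lambda>\<alpha>. (cmod (free_coeff f \<alpha>))\<^sup>2) summable_on UNIV}"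

definition H2_norm ::
  "(('n::finite \<Rightarrow> ('h::chilbert_space \<Rightarrow>\<^sub>L 'h)) \<Rightarrow> ('h \<Rightarrow>\<^sub>L 'h)) \<Rightarrow> real" where
  "H2_norm f = sqrt (\<Sum>\<^sub>\<infinity>\<alpha>. (cmod (free_coeff f \<alpha>))\<^sup>2)"

text \<open>The composition given by the series in the products
  \<open>\<phi>\<^sub>\<alpha>(X) = \<phi>\<^sub>i\<^sub>1(X) \<dots> \<phi>\<^sub>i\<^sub>k(X)\<close> is the ordinary composition of maps on the ball.\<close>

lemma comp_free_series:
  assumes "has_free_series f a" "free_self_map \<phi>" "X \<in> row_ball"
  shows "(\<lambda>k. \<Sum>\<alpha> | length \<alpha> = k. scaleC_op (a \<alpha>) (op_word (\<lambda>i. \<phi> X i) \<alpha>)) sums (f \<circ> \<phi>) X"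
  using assms by (simp add: has_free_series_def free_self_map_def)

end

theory Submission imports Defs begin

text \<open>A free holomorphic function is determined by its values at truncated weighted shifts acting on
  finitely many orthonormal vectors, and its coefficients can be read off these values. Since \<open>\<phi>\<close> maps such
  shifts into the row ball, left multiplication by the coordinates of \<open>\<phi>\<close> is a row contraction on
  square-summable coefficients. Because \<open>\<phi>\<close> has no constant term, Littlewood's subordination argument
  then applies to \<open>f = a\<^sub>0 + \<Sum>\<^sub>i X\<^sub>i f\<^sub>i\<close>: the constant is orthogonal to \<open>\<Sum>\<^sub>i \<phi>\<^sub>i (f\<^sub>i \<circ> \<phi>)\<close>, and induction
  on the degree bounds the \<open>l\<^sup>2\<close> norm of the formal composition. The same bound, with the geometric
  decay of homogeneous parts on the ball, shows that the formal composition sums to \<open>f \<circ> \<phi>\<close>.\<close>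

section \<open>Analytic preliminaries: Cauchy products and Riesz representation\<close>

interpretation CV: vector_space "scaleC :: complex \<Rightarrow> 'h \<Rightarrow> 'h::chilbert_space"
  by (rule vector_space_scaleC)

text \<open>The partial sums over the square \<open>S1 n\<close> tend to \<open>prod A B\<close>.
  Their difference from the sums over the triangle \<open>S2 n\<close> is dominated, up to
  \<open>K\<close>, by the same difference for the norms, which vanishes by the scalar Cauchy
  product. It is applied later with composition of operators as the product.\<close>

lemma (in bounded_bilinear) Cauchy_product_sums:
  assumes a: "summable (\<lambda>k. norm (a k))" and b: "summable (\<lambda>k. norm (b k))"
    and A: "a sums A" and B: "b sums B"
  shows "(\<lambda>k. \<Sum>i\<le>k. prod (a i) (b (k - i))) sums prod A B"
proof -
  obtain K where K: "\<And>x y. norm (prod x y) \<le> norm x * norm y * K" and K0: "K \<ge> 0"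
    using nonneg_bounded by blast
  define S1 where "S1 = (\<lambda>n::nat. {..<n} \<times> {..<n})"
  define S2 where "S2 = (\<lambda>n::nat. {(i,j). i + j < n})"
  have S21: "S2 n \<subseteq> S1 n" for n by (auto simp: S1_def S2_def)
  have fin: "finite (S1 n)" "finite (S2 n)" for n
    using S21[of n] finite_subset by (auto simp: S1_def)
  let ?g = "\<lambda>(i,j). prod (a i) (b j)"
  let ?f = "\<lambda>(i,j). norm (a i) * norm (b j)"
  have g1: "sum ?g (S1 n) = prod (sum a {..<n}) (sum b {..<n})" for n
    unfolding S1_def by (simp add: sum.cartesian_product[symmetric] sum_left sum_right) (rule sum.swap)
  have f1: "sum ?f (S1 n) = (\<Sum>i<n. norm (a i)) * (\<Sum>i<n. norm (b i))" for n
    unfolding S1_def by (simp add: sum.cartesian_product[symmetric] sum_product)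
  have g2: "sum ?g (S2 n) = (\<Sum>k<n. \<Sum>i\<le>k. prod (a i) (b (k - i)))" for n
    unfolding S2_def by (rule sum.triangle_reindex)
  have f2: "sum ?f (S2 n) = (\<Sum>k<n. \<Sum>i\<le>k. norm (a i) * norm (b (k - i)))" for n
    unfolding S2_def by (rule sum.triangle_reindex)
  have "(\<lambda>n. sum ?f (S1 n) - sum ?f (S2 n)) \<longlonglongrightarrow>
      (\<Sum>k. norm (a k)) * (\<Sum>k. norm (b k)) - (\<Sum>k. norm (a k)) * (\<Sum>k. norm (b k))"
    unfolding f1 f2
    using Series.Cauchy_product_sums[of "\<lambda>k. norm (a k)" "\<lambda>k. norm (b k)"] a b
    by (intro tendsto_diff tendsto_mult summable_LIMSEQ) (auto simp: sums_def)
  then have lim0: "(\<lambda>n. K * (sum ?f (S1 n) - sum ?f (S2 n))) \<longlonglongrightarrow> 0"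
    using tendsto_mult_right_zero by auto
  have "(\<lambda>n. sum ?g (S1 n) - sum ?g (S2 n)) \<longlonglongrightarrow> 0"
  proof (rule Lim_null_comparison[OF always_eventually lim0], rule allI)
    fix n
    have "norm (sum ?g (S1 n) - sum ?g (S2 n)) = norm (sum ?g (S1 n - S2 n))"
      by (simp add: sum_diff[OF fin(1) S21])
    also have "\<dots> \<le> (\<Sum>p\<in>S1 n - S2 n. K * ?f p)"
      by (rule sum_norm_le) (use K in \<open>auto simp: ac_simps\<close>)
    also have "\<dots> = K * (sum ?f (S1 n) - sum ?f (S2 n))"
      by (simp add: sum_diff[OF fin(1) S21] sum_distrib_left right_diff_distrib)
    finally show "norm (sum ?g (S1 n) - sum ?g (S2 n)) \<le> K * (sum ?f (S1 n) - sum ?f (S2 n))" .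
  qed
  moreover have "(\<lambda>n. sum ?g (S1 n)) \<longlonglongrightarrow> prod A B"
    unfolding g1 using A B by (intro tendsto) (auto simp: sums_def)
  ultimately have "(\<lambda>n. sum ?g (S2 n)) \<longlonglongrightarrow> prod A B"
    using Lim_transform2 tendsto_diff[of "\<lambda>n. sum ?g (S1 n)" "prod A B" sequentially
        "\<lambda>n. sum ?g (S1 n) - sum ?g (S2 n)" 0] by simp
  then show ?thesis by (simp add: g2 sums_def)
qed

text \<open>Variational proof: a minimizer \<open>z\<close> of the functional \<open>J\<close>
  exists by completeness, and stationarity of \<open>J\<close> at \<open>z\<close> in every
  direction says that \<open>z\<close> represents \<open>F\<close>.\<close>

lemma riesz_representation:
  fixes F :: "'a::{real_inner, complete_space} \<Rightarrow> real"
  assumes "bounded_linear F"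
  obtains z where "\<And>x. F x = inner z x"
proof -
  interpret F: bounded_linear F by fact
  define J where "J = (\<lambda>x. (norm x)\<^sup>2 / 2 - F x)"
  define m where "m = Inf (range J)"
  obtain K where K: "\<And>x. \<bar>F x\<bar> \<le> norm x * K" using F.bounded by auto
  have "J x \<ge> - K\<^sup>2 / 2" for x
  proof -
    have "0 \<le> (norm x - K)\<^sup>2" by simp
    then have "norm x * K \<le> (norm x)\<^sup>2 / 2 + K\<^sup>2 / 2" by (simp add: power2_diff)
    then show ?thesis using K[of x] by (simp add: J_def abs_le_iff)
  qed
  then have bdd: "bdd_below (range J)" by (rule bdd_belowI2)
  have m_le: "m \<le> J x" for x unfolding m_def by (rule cInf_lower[OF _ bdd]) simp
  have "\<exists>x. J x < m + 1 / Suc n" for n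
    using cInf_lessD[of "range J" "m + 1 / Suc n"] unfolding m_def by auto
  then obtain X where X: "\<And>n. J (X n) < m + 1 / Suc n" by metis
  \<comment> \<open>The midpoint of \<open>x\<close> and \<open>y\<close> has \<open>J\<close>-value
    below the average by an eighth of the squared distance, but never below \<open>m\<close>. Hence
    near-minimizers lie close together.\<close>
  have par: "(norm (x - y))\<^sup>2 \<le> 4 * (J x + J y - 2 * m)" for x y
  proof -
    have "J ((1/2) *\<^sub>R (x + y)) = (J x + J y) / 2 - (norm (x - y))\<^sup>2 / 8"
      unfolding J_def power2_norm_eq_inner F.scale F.add
      by (simp add: inner_add_left inner_add_right inner_diff_left inner_diff_right
          inner_commute field_simps)
    then show ?thesis using m_le[of "(1/2) *\<^sub>R (x + y)"] by (simp add: field_simps)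
  qed
  have "Cauchy X"
  proof (rule metric_CauchyI)
    fix e :: real assume e: "e > 0"
    \<comment> \<open>Beyond index \<open>N\<close> each excess over \<open>m\<close> is below
      \<open>1 / N\<close>, so \<open>par\<close> bounds the squared distance by
      \<open>8 / N\<close>.\<close>
    obtain N where N: "8 / e\<^sup>2 < real N" using reals_Archimedean2 by blast
    have N0: "real N > 0" using N e by (meson divide_pos_pos less_trans zero_less_numeral zero_less_power)
    have "8 / real N < e\<^sup>2" using N N0 e by (simp add: field_simps)
    have "dist (X i) (X j) < e" if "i \<ge> N" "j \<ge> N" for i j
    proof -
      have s: "1 / real (Suc k) \<le> 1 / real N" if "k \<ge> N" for k
        using that N0 by (intro divide_left_mono) auto
      have "(norm (X i - X j))\<^sup>2 < 4 * (1 / Suc i + 1 / Suc j)"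
        using par[of "X i" "X j"] X[of i] X[of j] by simp
      also have "\<dots> \<le> 8 / real N" using s[OF that(1)] s[OF that(2)] by simp
      also have "\<dots> < e\<^sup>2" by fact
      finally show ?thesis unfolding dist_norm by (rule power2_less_imp_less[OF _ less_imp_le[OF e]])
    qed
    then show "\<exists>M. \<forall>i\<ge>M. \<forall>j\<ge>M. dist (X i) (X j) < e" by blast
  qed
  then obtain z where z: "X \<longlonglongrightarrow> z" by (metis Cauchy_convergent convergentD)
  have "(\<lambda>n. J (X n)) \<longlonglongrightarrow> J z" unfolding J_def by (intro tendsto_intros F.tendsto z) simp
  moreover have "(\<lambda>n. m + 1 / Suc n) \<longlonglongrightarrow> m + 0"
    by (intro tendsto_add tendsto_const) (use LIMSEQ_inverse_real_of_nat in \<open>simp add: inverse_eq_divide\<close>)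
  ultimately have "J z \<le> m + 0"
    by (rule LIMSEQ_le) (use X less_imp_le in blast)
  then have Jz: "J z \<le> m" by simp
  have "F h = inner z h" for h
  proof (cases "h = 0")
    case False
    \<comment> \<open>This \<open>t\<close> minimizes the quadratic polynomial that \<open>J\<close>
      becomes on the line through \<open>z\<close> in direction \<open>h\<close>; a nonzero
      \<open>t\<close> would push \<open>J\<close> below \<open>m\<close>.\<close>
    define t where "t = (F h - inner z h) / (norm h)\<^sup>2"
    have h: "(norm h)\<^sup>2 > 0" using False by simp
    have th: "t * (norm h)\<^sup>2 = F h - inner z h" using h by (simp add: t_def)
    have "J (z + t *\<^sub>R h) = J z + t * inner z h + t * (t * (norm h)\<^sup>2) / 2 - t * F h"
      unfolding J_def power2_norm_eq_inner F.scale F.add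
      by (simp add: algebra_simps inner_commute power2_eq_square)
    also have "\<dots> = J z - t * (t * (norm h)\<^sup>2) / 2"
      unfolding th by (simp add: algebra_simps)
    finally have "t * (t * (norm h)\<^sup>2) \<le> 0" using m_le[of "z + t *\<^sub>R h"] Jz by simp
    then have "t\<^sup>2 * (norm h)\<^sup>2 \<le> 0" by (simp add: power2_eq_square mult.assoc)
    then have "t = 0" using h by (simp add: mult_le_0_iff)
    then show ?thesis using th by simp
  qed (simp add: F.zero)
  then show ?thesis by (rule that)
qed

section \<open>Complex inner products and adjoints\<close>

lemma cinner_add_right: "cinner x (y + z) = cinner x y + cinner (x::'h::chilbert_space) z"
  by (metis cinner_add_left cinner_commute complex_cnj_add)

lemma cinner_scaleC_right: "cinner x (c *\<^sub>C y) = cnj c * cinner (x::'h::chilbert_space) y"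
  by (metis cinner_scaleC_left cinner_commute complex_cnj_mult)

lemma cinner_zero_left [simp]: "cinner 0 (x::'h::chilbert_space) = 0"
  using cinner_add_left[of 0 0 x] by simp

lemma cinner_zero_right [simp]: "cinner (x::'h::chilbert_space) 0 = 0"
  using cinner_add_right[of x 0 0] by simp

lemma cinner_diff_left: "cinner (x - y) z = cinner x z - cinner (y::'h::chilbert_space) z"
  using cinner_add_left[of "x - y" y z] by simp

lemma cinner_sum_left: "cinner (sum f A) (z::'h::chilbert_space) = (\<Sum>i\<in>A. cinner (f i) z)"
  by (induction A rule: infinite_finite_induct) (auto simp: cinner_add_left)

lemma cinner_sum_right: "cinner (z::'h::chilbert_space) (sum f A) = (\<Sum>i\<in>A. cinner z (f i))"
  by (induction A rule: infinite_finite_induct) (auto simp: cinner_add_right)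

text \<open>The imaginary part of a number is the real part of its product with
  \<open>-\<i>\<close>, and that factor can be moved into the first argument. Facts about the real
  inner product thus transfer to \<open>cinner\<close>.\<close>

lemma cinner_eq_Complex_inner: "cinner x y = Complex (inner x y) (inner ((-\<i>) *\<^sub>C x) (y::'h::chilbert_space))"
  by (simp add: complex_eq_iff inner_eq_Re_cinner cinner_scaleC_left del: CV.scale_minus_left)

lemma cinner_self: "cinner x x = complex_of_real ((norm (x::'h::chilbert_space))\<^sup>2)"
proof -
  have "Im (cinner x x) = - Im (cinner x x)" by (metis cinner_commute cnj.simps(2))
  then show ?thesis by (simp add: complex_eq_iff power2_norm_eq_inner inner_eq_Re_cinner)
qed

text \<open>Real and imaginary parts are estimated separately, whence the factor 2; boundedness is
  all that is wanted from this estimate.\<close>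

lemma norm_cinner_le: "cmod (cinner x y) \<le> 2 * norm x * norm (y::'h::chilbert_space)"
proof -
  have "cmod (cinner x y) \<le> \<bar>inner x y\<bar> + \<bar>inner ((-\<i>) *\<^sub>C x) y\<bar>"
    unfolding cinner_eq_Complex_inner using cmod_le[of "Complex (inner x y) (inner ((-\<i>) *\<^sub>C x) y)"] by simp
  also have "\<dots> \<le> norm x * norm y + norm ((-\<i>) *\<^sub>C x) * norm y"
    by (intro add_mono Cauchy_Schwarz_ineq2)
  finally show ?thesis by (simp add: norm_scaleC)
qed

lemma bounded_linear_cinner_left: "bounded_linear (\<lambda>x. cinner x (y::'h::chilbert_space))"
  by (rule bounded_linear_intro[where K = "2 * norm y"])
    (auto simp: cinner_add_left scaleR_scaleC cinner_scaleC_left scaleR_conv_of_real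
      intro: order_trans[OF norm_cinner_le])

lemma is_adjoint_unique:
  fixes T :: "'h::chilbert_space \<Rightarrow> 'h"
  assumes "\<forall>x y. cinner (T x) y = cinner x (blinfun_apply S y)"
    and "\<forall>x y. cinner (T x) y = cinner x (blinfun_apply S' y)"
  shows "S = S'"
proof (rule blinfun_eqI)
  fix y
  have "cinner x (S y) = cinner x (S' y)" for x
    using assms by metis
  then have "inner x (S y - S' y) = 0" for x
    unfolding inner_diff_right by (simp add: inner_eq_Re_cinner)
  then show "S y = S' y" by (metis inner_eq_zero_iff right_minus_eq)
qed

lemma op_adj_eqI:
  assumes "\<And>x y. cinner (blinfun_apply T x) y = cinner x (blinfun_apply S y)"
  shows "op_adj T = S"
  unfolding op_adj_def
proof (rule the_equality)
  show "\<forall>x y. cinner (T x) y = cinner x (S y)" using assms by blast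
  then show "S' = S" if "\<forall>x y. cinner (T x) y = cinner x (blinfun_apply S' y)" for S'
    using that is_adjoint_unique by metis
qed

text \<open>Riesz representation for the real inner product yields a real adjoint; complex linearity
  of \<open>T\<close> then makes it the complex one.\<close>

lemma adjoint_exists:
  assumes T: "T \<in> BH"
  shows "\<exists>S. \<forall>x y. cinner (blinfun_apply T x) y = cinner x (blinfun_apply S y)"
proof -
  have Tc: "T (c *\<^sub>C x) = c *\<^sub>C T x" for c x using T by (simp add: BH_def)
  have "\<exists>z. \<forall>x. inner (T x) y = inner z x" for y
    using riesz_representation[of "\<lambda>x. inner (T x) y"]
    by (metis bounded_linear_inner_left_comp blinfun.bounded_linear_right)
  then obtain S where S: "\<And>x y. inner (T x) y = inner (S y) x" by metis
  have S': "inner (S y) x = inner (T x) y" for x y by (simp add: S)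
  have eqI: "u = v" if "\<And>x. inner u x = inner v x" for u v :: 'a
    using that[of "u - v"] by (metis inner_diff_left inner_eq_zero_iff right_minus_eq)
  have "bounded_linear S"
  proof (rule bounded_linear_intro[where K = "norm T"])
    show "S (x + y) = S x + S y" for x y
      by (rule eqI) (simp add: S' inner_add_left inner_add_right)
    show "S (r *\<^sub>R x) = r *\<^sub>R S x" for r x by (rule eqI) (simp add: S')
    show "norm (S x) \<le> norm x * norm T" for x
    proof (cases "S x = 0")
      case False
      have "norm (S x) * norm (S x) = inner (T (S x)) x"
        by (simp add: S' [symmetric] dot_square_norm power2_eq_square)
      also have "\<dots> \<le> norm (T (S x)) * norm x" by (rule norm_cauchy_schwarz)
      also have "\<dots> \<le> norm T * norm (S x) * norm x"
        by (intro mult_right_mono norm_blinfun) auto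
      finally show ?thesis using False by (simp add: ac_simps)
    qed simp
  qed
  then obtain S0 where S0: "blinfun_apply S0 = S" by (metis bounded_linear_Blinfun_apply)
  \<comment> \<open>The factor \<open>-\<i>\<close> of the imaginary part passes through
    \<open>T\<close>, so both parts are instances of the real adjoint relation.\<close>
  have "cinner (T x) y = cinner x (S0 y)" for x y
    unfolding cinner_eq_Complex_inner S0 Tc[symmetric] S by (simp add: inner_commute)
  then show ?thesis by blast
qed

lemma cinner_op_adj: "T \<in> BH \<Longrightarrow> cinner (blinfun_apply T x) y = cinner x (blinfun_apply (op_adj T) y)"
  using adjoint_exists[of T] op_adj_eqI[of T] by metis

lemma inner_op_adj: "T \<in> BH \<Longrightarrow> inner (blinfun_apply T x) y = inner x (blinfun_apply (op_adj T) y)"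
  by (simp add: inner_eq_Re_cinner cinner_op_adj)

section \<open>Norm estimates for row operators\<close>

definition row_norm :: "('n::finite \<Rightarrow> ('h::chilbert_space \<Rightarrow>\<^sub>L 'h)) \<Rightarrow> real" where
  "row_norm X = sqrt (norm (\<Sum>i\<in>UNIV. X i o\<^sub>L op_adj (X i)))"

lemma row_ball_iff: "X \<in> row_ball \<longleftrightarrow> (\<forall>i. X i \<in> BH) \<and> row_norm X < 1"
  by (simp add: row_ball_def row_norm_def)

lemma row_norm_nonneg: "row_norm X \<ge> 0"
  by (simp add: row_norm_def)

text \<open>Pair \<open>y\<close>, the value of the row operator, with itself and move each
  \<open>X i\<close> to the other side: Cauchy-Schwarz leaves the column of adjoints applied to
  \<open>y\<close>. The squared norm of that column is the quadratic form at \<open>y\<close> of the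
  operator whose norm defines \<open>row_norm X\<close>.\<close>

lemma row_norm_bound:
  fixes X :: "'n::finite \<Rightarrow> ('h::chilbert_space \<Rightarrow>\<^sub>L 'h)"
  assumes X: "\<And>i. X i \<in> BH"
  shows "(norm (\<Sum>i\<in>UNIV. blinfun_apply (X i) (h i)))\<^sup>2 \<le> (row_norm X)\<^sup>2 * (\<Sum>i\<in>UNIV. (norm (h i))\<^sup>2)"
proof -
  define y where "y = (\<Sum>i\<in>UNIV. X i (h i))"
  define H where "H = L2_set (\<lambda>i. norm (h i)) UNIV"
  define Q where "Q = L2_set (\<lambda>i. norm (op_adj (X i) y)) UNIV"
  have H2: "H\<^sup>2 = (\<Sum>i\<in>UNIV. (norm (h i))\<^sup>2)" by (simp add: H_def L2_set_def sum_nonneg)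
  have "Q\<^sup>2 = (\<Sum>i\<in>UNIV. inner (op_adj (X i) y) (op_adj (X i) y))"
    by (simp add: Q_def L2_set_def sum_nonneg power2_norm_eq_inner)
  also have "\<dots> = (\<Sum>i\<in>UNIV. inner (X i (op_adj (X i) y)) y)"
    by (simp add: inner_op_adj[OF X])
  also have "\<dots> = inner ((\<Sum>i\<in>UNIV. X i o\<^sub>L op_adj (X i)) y) y"
    by (simp add: blinfun.sum_left inner_sum_left)
  also have "\<dots> \<le> norm ((\<Sum>i\<in>UNIV. X i o\<^sub>L op_adj (X i)) y) * norm y" by (rule norm_cauchy_schwarz)
  also have "\<dots> \<le> norm (\<Sum>i\<in>UNIV. X i o\<^sub>L op_adj (X i)) * norm y * norm y"
    by (intro mult_right_mono norm_blinfun) auto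
  also have "\<dots> = (row_norm X * norm y)\<^sup>2"
    by (simp add: row_norm_def power_mult_distrib power2_eq_square)
  finally have Q: "Q \<le> row_norm X * norm y"
    by (rule power2_le_imp_le) (simp add: row_norm_nonneg)
  have "norm y * norm y = inner (\<Sum>i\<in>UNIV. X i (h i)) y"
    by (simp add: y_def [symmetric] dot_square_norm power2_eq_square)
  also have "\<dots> = (\<Sum>i\<in>UNIV. inner (h i) (op_adj (X i) y))"
    by (simp add: inner_sum_left inner_op_adj[OF X])
  also have "\<dots> \<le> (\<Sum>i\<in>UNIV. \<bar>norm (h i)\<bar> * \<bar>norm (op_adj (X i) y)\<bar>)"
    by (rule sum_mono) (simp add: norm_cauchy_schwarz)
  also have "\<dots> \<le> H * Q" unfolding H_def Q_def by (rule L2_set_mult_ineq)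
  also have "\<dots> \<le> H * (row_norm X * norm y)"
    using Q by (intro mult_left_mono) (simp_all add: H_def)
  finally have "norm y * norm y \<le> (row_norm X * H) * norm y" by (simp add: ac_simps)
  then have "norm y \<le> row_norm X * H"
    by (cases "y = 0") (auto simp: row_norm_nonneg H_def)
  then have "(norm y)\<^sup>2 \<le> (row_norm X * H)\<^sup>2" by (intro power_mono) auto
  then show ?thesis by (simp add: power_mult_distrib H2 y_def)
qed

section \<open>Words, orthonormal families and truncated shifts\<close>

lemma finite_words_length [simp]: "finite {\<alpha> :: 'n::finite list. length \<alpha> = k}"
  using finite_lists_length_eq[of "UNIV :: 'n set" k] by simp

lemma finite_words_length_le [simp]: "finite {\<alpha> :: 'n::finite list. length \<alpha> \<le> k}"
  using finite_lists_length_le[of "UNIV :: 'n set" k] by simp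

lemma sum_words_Suc:
  fixes F :: "'n::finite list \<Rightarrow> 'b::comm_monoid_add"
  shows "(\<Sum>\<alpha> | length \<alpha> = Suc k. F \<alpha>) = (\<Sum>i\<in>UNIV. \<Sum>\<alpha> | length \<alpha> = k. F (i # \<alpha>))"
proof -
  have "(\<Sum>\<alpha> | length \<alpha> = Suc k. F \<alpha>) = (\<Sum>(i, \<alpha>)\<in>UNIV \<times> {\<alpha>. length \<alpha> = k}. F (i # \<alpha>))"
    by (rule sum.reindex_bij_witness[where i = "\<lambda>(i, \<alpha>). i # \<alpha>" and j = "\<lambda>\<alpha>. (hd \<alpha>, tl \<alpha>)"])
      (auto simp: length_Suc_conv)
  then show ?thesis by (simp add: sum.cartesian_product)
qed

lemma sum_words_le_by_length:
  fixes F :: "'n::finite list \<Rightarrow> 'b::comm_monoid_add"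
  shows "(\<Sum>\<alpha> | length \<alpha> \<le> N. F \<alpha>) = (\<Sum>k\<le>N. \<Sum>\<alpha> | length \<alpha> = k. F \<alpha>)"
proof -
  have "{\<alpha> :: 'n list. length \<alpha> \<le> N} = (\<Union>k\<in>{..N}. {\<alpha>. length \<alpha> = k})" by auto
  then show ?thesis by (simp, subst sum.UNION_disjoint) auto
qed

lemma sum_words_le_Suc:
  fixes F :: "'n::finite list \<Rightarrow> 'b::comm_monoid_add"
  shows "(\<Sum>\<alpha> | length \<alpha> \<le> Suc N. F \<alpha>) = F [] + (\<Sum>i\<in>UNIV. \<Sum>\<alpha> | length \<alpha> \<le> N. F (i # \<alpha>))"
proof -
  have "(\<Sum>\<alpha> | length \<alpha> \<le> Suc N. F \<alpha>) = F [] + (\<Sum>k\<le>N. \<Sum>\<alpha> | length \<alpha> = Suc k. F \<alpha>)"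
    unfolding sum_words_le_by_length sum.atMost_Suc_shift by simp
  also have "(\<Sum>k\<le>N. \<Sum>\<alpha> | length \<alpha> = Suc k. F \<alpha>) = (\<Sum>i\<in>UNIV. \<Sum>\<alpha> | length \<alpha> \<le> N. F (i # \<alpha>))"
    unfolding sum_words_le_by_length sum_words_Suc by (rule sum.swap)
  finally show ?thesis .
qed

definition orthonormal_on :: "'b set \<Rightarrow> ('b \<Rightarrow> 'h::chilbert_space) \<Rightarrow> bool" where
  "orthonormal_on A e \<longleftrightarrow> (\<forall>a\<in>A. \<forall>b\<in>A. cinner (e a) (e b) = (if a = b then 1 else 0))"

lemma orthonormal_onD:
  "orthonormal_on A e \<Longrightarrow> a \<in> A \<Longrightarrow> b \<in> A \<Longrightarrow> cinner (e a) (e b) = (if a = b then 1 else 0)"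
  by (simp add: orthonormal_on_def)

text \<open>Gram-Schmidt: finitely many vectors never span the space, so a vector outside their span
  is always available. Infinite dimension enters the development through this lemma alone.\<close>

lemma orthonormal_on_exists:
  assumes inf: "\<nexists>B :: 'h::chilbert_space set. finite B \<and> module.span scaleC B = UNIV"
    and "finite (A :: 'b set)"
  shows "\<exists>e :: 'b \<Rightarrow> 'h. orthonormal_on A e"
  using \<open>finite A\<close>
proof induction
  case empty
  then show ?case by (simp add: orthonormal_on_def)
next
  case (insert a A)
  then obtain e :: "'b \<Rightarrow> 'h" where e: "orthonormal_on A e" by blast
  have "CV.span (e ` A) \<noteq> UNIV" using inf insert.hyps(1) by blast
  then obtain x where x: "x \<notin> CV.span (e ` A)" by blast
  define y where "y = x - (\<Sum>b\<in>A. cinner x (e b) *\<^sub>C e b)"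
  have "(\<Sum>b\<in>A. cinner x (e b) *\<^sub>C e b) \<in> CV.span (e ` A)"
    by (intro CV.span_sum CV.span_scale CV.span_base) auto
  then have y0: "y \<noteq> 0" using x by (auto simp: y_def)
  have yb: "cinner y (e b) = 0" if "b \<in> A" for b
  proof -
    have "(\<Sum>c\<in>A. cinner x (e c) * cinner (e c) (e b)) = (\<Sum>c\<in>A. if c = b then cinner x (e c) else 0)"
      by (rule sum.cong) (auto simp: orthonormal_onD[OF e _ that])
    then show ?thesis using insert.hyps(1) that
      by (simp add: y_def cinner_diff_left cinner_sum_left cinner_scaleC_left sum.delta)
  qed
  have by': "cinner (e b) y = 0" if "b \<in> A" for b
    using yb[OF that] cinner_commute[of "e b" y] by simp
  define z where "z = complex_of_real (1 / norm y) *\<^sub>C y"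
  have "cinner z z = 1"
    using y0 by (simp add: z_def cinner_self norm_scaleC norm_divide)
  then have "orthonormal_on (insert a A) (e(a := z))"
    using insert.hyps(2) by (auto simp: orthonormal_on_def z_def cinner_scaleC_left
        cinner_scaleC_right yb by' orthonormal_onD[OF e])
  then show ?case by blast
qed

lemma norm_sum_orthonormal:
  fixes e :: "'b \<Rightarrow> 'h::chilbert_space"
  assumes "orthonormal_on A e" "finite A"
  shows "(norm (\<Sum>a\<in>A. c a *\<^sub>C e a))\<^sup>2 = (\<Sum>a\<in>A. (cmod (c a))\<^sup>2)"
proof -
  have "complex_of_real ((norm (\<Sum>a\<in>A. c a *\<^sub>C e a))\<^sup>2)
      = (\<Sum>a\<in>A. \<Sum>b\<in>A. c a * cnj (c b) * cinner (e a) (e b))"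
    unfolding cinner_self[symmetric] cinner_sum_left cinner_scaleC_left
    unfolding cinner_sum_right cinner_scaleC_right
    by (simp add: sum_distrib_left mult.assoc)
  also have "\<dots> = (\<Sum>a\<in>A. \<Sum>b\<in>A. if b = a then c a * cnj (c b) else 0)"
    by (intro sum.cong refl) (auto simp: orthonormal_onD[OF assms(1)])
  also have "\<dots> = complex_of_real (\<Sum>a\<in>A. (cmod (c a))\<^sup>2)"
    using assms(2) by (simp add: complex_norm_square[symmetric])
  finally show ?thesis unfolding of_real_eq_iff .
qed

text \<open>The projection \<open>p\<close> of \<open>x\<close> satisfies
  \<open>inner x p = (norm p)^2\<close>, so Cauchy-Schwarz gives \<open>norm p\<close> at most
  \<open>norm x\<close>.\<close>

lemma bessel_inequality:
  fixes e :: "'b \<Rightarrow> 'h::chilbert_space"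
  assumes e: "orthonormal_on A e" "finite A"
  shows "(\<Sum>a\<in>A. (cmod (cinner x (e a)))\<^sup>2) \<le> (norm x)\<^sup>2"
proof -
  define p where "p = (\<Sum>a\<in>A. cinner x (e a) *\<^sub>C e a)"
  have np: "(norm p)\<^sup>2 = (\<Sum>a\<in>A. (cmod (cinner x (e a)))\<^sup>2)"
    unfolding p_def by (rule norm_sum_orthonormal[OF e])
  have "cinner x p = complex_of_real (\<Sum>a\<in>A. (cmod (cinner x (e a)))\<^sup>2)"
    unfolding p_def of_real_sum complex_norm_square cinner_sum_right cinner_scaleC_right
    by (simp add: mult.commute)
  then have "inner x p = (norm p)\<^sup>2" by (simp add: inner_eq_Re_cinner np)
  then have "norm p * norm p \<le> norm x * norm p"
    using norm_cauchy_schwarz[of x p] by (simp add: power2_eq_square)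
  then have "norm p \<le> norm x" by (cases "p = 0") auto
  then show ?thesis unfolding np[symmetric] by (simp add: power_mono)
qed

text \<open>The compression of the left creation operators to words of length at most \<open>N\<close>, scaled by
  \<open>r\<close> and transplanted to the span of the \<open>e \<gamma>\<close>. On coefficients it strips the leading letter.\<close>

definition trunc_shift ::
  "real \<Rightarrow> nat \<Rightarrow> ('n::finite list \<Rightarrow> 'h::chilbert_space) \<Rightarrow> 'n \<Rightarrow> ('h \<Rightarrow>\<^sub>L 'h)" where
  "trunc_shift r N e i =
     Blinfun (\<lambda>x. \<Sum>\<beta> | length \<beta> < N. (complex_of_real r * cinner x (e \<beta>)) *\<^sub>C e (i # \<beta>))"

definition trunc_shift_adj ::
  "real \<Rightarrow> nat \<Rightarrow> ('n::finite list \<Rightarrow> 'h::chilbert_space) \<Rightarrow> 'n \<Rightarrow> ('h \<Rightarrow>\<^sub>L 'h)" where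
  "trunc_shift_adj r N e i =
     Blinfun (\<lambda>x. \<Sum>\<beta> | length \<beta> < N. (complex_of_real r * cinner x (e (i # \<beta>))) *\<^sub>C e \<beta>)"

lemma bounded_linear_rank_one:
  "bounded_linear (\<lambda>x. (c * cinner x y) *\<^sub>C (z :: 'h::chilbert_space))"
proof (rule bounded_linear_intro[where K = "cmod c * (2 * norm y) * norm z"])
  show "norm ((c * cinner x y) *\<^sub>C z) \<le> norm x * (cmod c * (2 * norm y) * norm z)" for x
    using mult_left_mono[OF norm_cinner_le[of x y], of "cmod c * norm z"]
    by (simp add: norm_scaleC norm_mult ac_simps)
qed (auto simp: cinner_add_left scaleR_scaleC cinner_scaleC_left scaleC_scaleC
    ring_distribs scaleC_add_left ac_simps)

lemma finite_words_length_less [simp]: "finite {\<alpha> :: 'n::finite list. length \<alpha> < k}"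
  by (rule finite_subset[OF _ finite_words_length_le[of k]]) auto

lemma trunc_shift_apply:
  "blinfun_apply (trunc_shift r N e i) x = (\<Sum>\<beta> | length \<beta> < N. (complex_of_real r * cinner x (e \<beta>)) *\<^sub>C e (i # \<beta>))"
  unfolding trunc_shift_def
  by (subst bounded_linear_Blinfun_apply) (intro bounded_linear_sum bounded_linear_rank_one, simp)

lemma trunc_shift_adj_apply:
  "blinfun_apply (trunc_shift_adj r N e i) x = (\<Sum>\<beta> | length \<beta> < N. (complex_of_real r * cinner x (e (i # \<beta>))) *\<^sub>C e \<beta>)"
  unfolding trunc_shift_adj_def
  by (subst bounded_linear_Blinfun_apply) (intro bounded_linear_sum bounded_linear_rank_one, simp)

lemma trunc_shift_BH: "trunc_shift r N e i \<in> BH"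
  by (simp add: BH_def trunc_shift_apply cinner_scaleC_left CV.scale_sum_right scaleC_scaleC ac_simps)

lemma op_adj_trunc_shift: "op_adj (trunc_shift r N e i) = trunc_shift_adj r N e i"
  by (rule op_adj_eqI)
    (simp add: trunc_shift_apply trunc_shift_adj_apply cinner_sum_left cinner_sum_right
      cinner_scaleC_left cinner_scaleC_right cinner_commute[symmetric] ac_simps)

lemma cinner_trunc_shift:
  assumes e: "orthonormal_on {\<alpha>. length \<alpha> \<le> N} e" and \<gamma>: "length \<gamma> \<le> N"
  shows "cinner (blinfun_apply (trunc_shift r N e i) x) (e \<gamma>) =
    (if \<gamma> \<noteq> [] \<and> hd \<gamma> = i then complex_of_real r * cinner x (e (tl \<gamma>)) else 0)"
proof -
  have "cinner (blinfun_apply (trunc_shift r N e i) x) (e \<gamma>) =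
      (\<Sum>\<beta> | length \<beta> < N. complex_of_real r * cinner x (e \<beta>) * cinner (e (i # \<beta>)) (e \<gamma>))"
    by (simp add: trunc_shift_apply cinner_sum_left cinner_scaleC_left)
  also have "\<dots> = (\<Sum>\<beta> | length \<beta> < N. if \<beta> = tl \<gamma> then
      (if \<gamma> \<noteq> [] \<and> hd \<gamma> = i then complex_of_real r * cinner x (e (tl \<gamma>)) else 0) else 0)"
    using \<gamma> by (intro sum.cong refl) (cases \<gamma>, auto simp: orthonormal_onD[OF e])
  also have "\<dots> = (if \<gamma> \<noteq> [] \<and> hd \<gamma> = i then complex_of_real r * cinner x (e (tl \<gamma>)) else 0)"
    using \<gamma> by (cases \<gamma>) auto
  finally show ?thesis .
qed

text \<open>Each letter strips itself from the front of \<open>\<gamma>\<close>, so only a suffix of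
  \<open>\<gamma>\<close> is consulted. Hence the truncation at length \<open>N\<close> distorts no
  coefficient up to that length.\<close>

lemma cinner_op_word_trunc_shift:
  assumes e: "orthonormal_on {\<alpha>. length \<alpha> \<le> N} e" and \<gamma>: "length \<gamma> \<le> N"
  shows "cinner (blinfun_apply (op_word (trunc_shift r N e) \<alpha>) x) (e \<gamma>) =
    (if take (length \<alpha>) \<gamma> = \<alpha> then complex_of_real r ^ length \<alpha> * cinner x (e (drop (length \<alpha>) \<gamma>)) else 0)"
  using \<gamma>
proof (induction \<alpha> arbitrary: \<gamma>)
  case Nil
  then show ?case by (simp add: op_word_def)
next
  case (Cons i \<alpha>)
  have "blinfun_apply (op_word (trunc_shift r N e) (i # \<alpha>)) x
      = blinfun_apply (trunc_shift r N e i) (blinfun_apply (op_word (trunc_shift r N e) \<alpha>) x)"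
    by (simp add: op_word_def)
  then show ?case using Cons.prems
    by (cases \<gamma>) (auto simp: cinner_trunc_shift[OF e] Cons.IH)
qed

text \<open>The vectors \<open>e (i # \<beta>)\<close> are orthonormal across all \<open>i\<close>
  and \<open>\<beta>\<close>, so \<open>?P\<close> is \<open>r^2\<close> times the orthogonal
  projection onto the span of the \<open>e \<gamma>\<close> with \<open>\<gamma>\<close> nonempty of
  length at most \<open>N\<close>.\<close>

lemma row_norm_trunc_shift:
  assumes e: "orthonormal_on {\<alpha>. length \<alpha> \<le> N} e" and r: "0 \<le> r"
  shows "row_norm (trunc_shift r N e) \<le> r"
proof -
  let ?S = "trunc_shift r N e"
  let ?P = "\<Sum>i\<in>UNIV. ?S i o\<^sub>L op_adj (?S i)"
  have "norm ?P \<le> r\<^sup>2"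
  proof (rule norm_blinfun_bound)
    fix x
    define A where "A = (UNIV :: 'a set) \<times> {\<beta> :: 'a list. length \<beta> < N}"
    have fA: "finite A" by (simp add: A_def)
    have oA: "orthonormal_on A (\<lambda>(i, \<beta>). e (i # \<beta>))"
      using e by (auto simp: orthonormal_on_def A_def)
    have c: "cinner (\<Sum>\<beta> | length \<beta> < N. c \<beta> *\<^sub>C e \<beta>) (e \<beta>') = c \<beta>'" if "length \<beta>' < N" for c and \<beta>' :: "'a list"
    proof -
      have "cinner (\<Sum>\<beta> | length \<beta> < N. c \<beta> *\<^sub>C e \<beta>) (e \<beta>') =
          (\<Sum>\<beta> | length \<beta> < N. if \<beta> = \<beta>' then c \<beta> else 0)"
        unfolding cinner_sum_left cinner_scaleC_left
        using that by (intro sum.cong refl) (auto simp: orthonormal_onD[OF e])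
      then show ?thesis using that by simp
    qed
    have "blinfun_apply ?P x = (\<Sum>(i, \<beta>)\<in>A. (r * (complex_of_real r * cinner x (e (i # \<beta>)))) *\<^sub>C e (i # \<beta>))"
      by (simp add: blinfun.sum_left op_adj_trunc_shift trunc_shift_apply trunc_shift_adj_apply c
          A_def sum.cartesian_product)
    then have "(norm (blinfun_apply ?P x))\<^sup>2 = (\<Sum>a\<in>A. (cmod (r * (complex_of_real r * cinner x (case a of (i, \<beta>) \<Rightarrow> e (i # \<beta>)))))\<^sup>2)"
      using norm_sum_orthonormal[OF oA fA, of "\<lambda>a. r * (complex_of_real r * cinner x (case a of (i, \<beta>) \<Rightarrow> e (i # \<beta>)))"]
      by (simp add: case_prod_unfold)
    also have "\<dots> = (r\<^sup>2)\<^sup>2 * (\<Sum>a\<in>A. (cmod (cinner x (case a of (i, \<beta>) \<Rightarrow> e (i # \<beta>))))\<^sup>2)"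
      by (simp add: sum_distrib_left norm_mult power_mult_distrib power2_eq_square ac_simps r)
    also have "\<dots> \<le> (r\<^sup>2)\<^sup>2 * (norm x)\<^sup>2"
      by (intro mult_left_mono bessel_inequality[OF oA fA]) simp
    finally have "(norm (blinfun_apply ?P x))\<^sup>2 \<le> (r\<^sup>2 * norm x)\<^sup>2" by (simp add: power_mult_distrib)
    then show "norm (blinfun_apply ?P x) \<le> r\<^sup>2 * norm x" by (rule power2_le_imp_le) simp
  qed simp
  then have "sqrt (norm ?P) \<le> sqrt (r\<^sup>2)" by (rule real_sqrt_le_mono)
  then show ?thesis using r by (simp add: row_norm_def)
qed

section \<open>Coefficients of free series and of compositions\<close>

lemma scaleC_op_apply [simp]: "blinfun_apply (scaleC_op c T) x = c *\<^sub>C blinfun_apply T x"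
  by (simp add: scaleC_op.rep_eq)

definition hom_part ::
  "('n::finite \<Rightarrow> ('h::chilbert_space \<Rightarrow>\<^sub>L 'h)) \<Rightarrow> ('n list \<Rightarrow> complex) \<Rightarrow> nat \<Rightarrow> ('h \<Rightarrow>\<^sub>L 'h)" where
  "hom_part X a k = (\<Sum>\<alpha> | length \<alpha> = k. scaleC_op (a \<alpha>) (op_word X \<alpha>))"

lemma has_free_series_sums:
  "has_free_series f a \<Longrightarrow> X \<in> row_ball \<Longrightarrow> hom_part X a sums f X"
  by (simp add: has_free_series_def hom_part_def[abs_def])

lemma hom_part_apply:
  "blinfun_apply (hom_part X a k) x = (\<Sum>\<alpha> | length \<alpha> = k. a \<alpha> *\<^sub>C blinfun_apply (op_word X \<alpha>) x)"
  by (simp add: hom_part_def blinfun.sum_left)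

lemma op_word_BH:
  assumes "\<And>i. X i \<in> BH"
  shows "op_word X \<alpha> \<in> BH"
  using assms by (induction \<alpha>) (auto simp: op_word_def BH_def)

lemma cinner_hom_part_trunc_shift:
  assumes e: "orthonormal_on {\<alpha>. length \<alpha> \<le> N} e" and \<gamma>: "length \<gamma> \<le> N"
  shows "cinner (blinfun_apply (hom_part (trunc_shift r N e) a k) x) (e \<gamma>) =
    (if k \<le> length \<gamma> then complex_of_real r ^ k * a (take k \<gamma>) * cinner x (e (drop k \<gamma>)) else 0)"
proof (cases "k \<le> length \<gamma>")
  case True
  have "cinner (blinfun_apply (hom_part (trunc_shift r N e) a k) x) (e \<gamma>) =
      (\<Sum>\<alpha> | length \<alpha> = k. if \<alpha> = take k \<gamma> then
        complex_of_real r ^ k * a (take k \<gamma>) * cinner x (e (drop k \<gamma>)) else 0)"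
    unfolding hom_part_apply cinner_sum_left cinner_scaleC_left cinner_op_word_trunc_shift[OF e \<gamma>]
    using True by (intro sum.cong refl) auto
  then show ?thesis using True by simp
next
  case False
  then have "take (length \<alpha>) \<gamma> \<noteq> \<alpha>" if "length \<alpha> = k" for \<alpha>
    using that by (metis length_take min.cobounded1)
  then show ?thesis using False
    by (simp add: hom_part_apply cinner_sum_left cinner_scaleC_left
        cinner_op_word_trunc_shift[OF e \<gamma>])
qed

text \<open>Homogeneous parts of degree above \<open>length \<gamma>\<close> have no component along
  \<open>e \<gamma>\<close>, so the series collapses to a finite sum. For \<open>r = 1\<close> that
  sum would be the convolution of the coefficients of the series with those of
  \<open>x\<close>.\<close>

lemma cinner_free_series_trunc_shift:
  fixes f :: "('n::finite \<Rightarrow> ('h::chilbert_space \<Rightarrow>\<^sub>L 'h)) \<Rightarrow> ('h \<Rightarrow>\<^sub>L 'h)"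
  assumes f: "has_free_series f a" and e: "orthonormal_on {\<alpha>. length \<alpha> \<le> N} e"
    and r: "0 \<le> r" "r < 1" and \<gamma>: "length \<gamma> \<le> N"
  shows "cinner (blinfun_apply (f (trunc_shift r N e)) x) (e \<gamma>) =
    (\<Sum>k\<le>length \<gamma>. complex_of_real r ^ k * a (take k \<gamma>) * cinner x (e (drop k \<gamma>)))"
proof -
  have "trunc_shift r N e \<in> row_ball"
    using row_norm_trunc_shift[OF e r(1)] r(2) by (simp add: row_ball_iff trunc_shift_BH)
  then have "hom_part (trunc_shift r N e) a sums f (trunc_shift r N e)"
    by (rule has_free_series_sums[OF f])
  then have "(\<lambda>k. cinner (blinfun_apply (hom_part (trunc_shift r N e) a k) x) (e \<gamma>)) sums
      cinner (blinfun_apply (f (trunc_shift r N e)) x) (e \<gamma>)"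
    by (intro bounded_linear.sums[OF bounded_linear_cinner_left]
        bounded_linear.sums[OF blinfun.bounded_linear_left])
  moreover have "(\<lambda>k. cinner (blinfun_apply (hom_part (trunc_shift r N e) a k) x) (e \<gamma>)) sums
      (\<Sum>k\<le>length \<gamma>. cinner (blinfun_apply (hom_part (trunc_shift r N e) a k) x) (e \<gamma>))"
    by (intro sums_finite) (auto simp: cinner_hom_part_trunc_shift[OF e \<gamma>])
  ultimately show ?thesis
    by (auto simp: cinner_hom_part_trunc_shift[OF e \<gamma>] dest: sums_unique2)
qed

lemma has_free_series_unique:
  fixes f :: "('n::finite \<Rightarrow> ('h::chilbert_space \<Rightarrow>\<^sub>L 'h)) \<Rightarrow> ('h \<Rightarrow>\<^sub>L 'h)"
  assumes inf: "\<nexists>B :: 'h set. finite B \<and> module.span scaleC B = UNIV"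
    and f: "has_free_series f a" "has_free_series f b"
  shows "a = b"
proof
  fix \<gamma> :: "'n list"
  obtain e :: "'n list \<Rightarrow> 'h" where e: "orthonormal_on {\<alpha>. length \<alpha> \<le> length \<gamma>} e"
    using orthonormal_on_exists[OF inf finite_words_length_le] by blast
  \<comment> \<open>Applied to the vacuum vector \<open>e []\<close>, only the term with
    \<open>k = length \<gamma>\<close> survives. The weight \<open>1/2\<close> stands for any radius
    strictly between 0 and 1.\<close>
  have *: "cinner (blinfun_apply (f (trunc_shift (1/2) (length \<gamma>) e)) (e [])) (e \<gamma>) =
      complex_of_real (1/2) ^ length \<gamma> * c \<gamma>" if c: "has_free_series f c" for c
  proof -
    have "cinner (blinfun_apply (f (trunc_shift (1/2) (length \<gamma>) e)) (e [])) (e \<gamma>) =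
      (\<Sum>k\<le>length \<gamma>. if k = length \<gamma> then complex_of_real (1/2) ^ length \<gamma> * c \<gamma> else 0)"
      unfolding cinner_free_series_trunc_shift[OF c e _ _ order_refl, of "1/2" "e []", simplified]
      by (intro sum.cong refl) (auto simp: orthonormal_onD[OF e])
    then show ?thesis by simp
  qed
  show "a \<gamma> = b \<gamma>" using *[OF f(1)] *[OF f(2)] by simp
qed

lemma free_coeff_eqI:
  fixes f :: "('n::finite \<Rightarrow> ('h::chilbert_space \<Rightarrow>\<^sub>L 'h)) \<Rightarrow> ('h \<Rightarrow>\<^sub>L 'h)"
  assumes "\<nexists>B :: 'h set. finite B \<and> module.span scaleC B = UNIV" and "has_free_series f a"
  shows "free_coeff f = a"
  unfolding free_coeff_def using assms has_free_series_unique by blast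

section \<open>Formal products and compositions of coefficient families\<close>

text \<open>These are the coefficients of the product of two free series. The variables do not
  commute, so the splittings of a word into prefix and suffix are all its factorizations.\<close>

definition word_conv :: "('n list \<Rightarrow> complex) \<Rightarrow> ('n list \<Rightarrow> complex) \<Rightarrow> 'n list \<Rightarrow> complex" where
  "word_conv c g \<gamma> = (\<Sum>k\<le>length \<gamma>. c (take k \<gamma>) * g (drop k \<gamma>))"

text \<open>Evaluate \<open>\<phi>\<close> at truncated shifts and let the scaling factor tend to \<open>1\<close>.\<close>

lemma self_map_row_contraction:
  fixes \<phi> :: "('n::finite \<Rightarrow> ('h::chilbert_space \<Rightarrow>\<^sub>L 'h)) \<Rightarrow> ('n \<Rightarrow> ('h \<Rightarrow>\<^sub>L 'h))"
  assumes inf: "\<nexists>B :: 'h set. finite B \<and> module.span scaleC B = UNIV"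
    and \<phi>: "\<And>X. X \<in> row_ball \<Longrightarrow> \<phi> X \<in> row_ball"
    and c: "\<And>i. has_free_series (\<lambda>X. \<phi> X i) (c i)"
  shows "(\<Sum>\<gamma> | length \<gamma> \<le> N. (cmod (\<Sum>i\<in>UNIV. word_conv (c i) (g i) \<gamma>))\<^sup>2)
    \<le> (\<Sum>i\<in>UNIV. \<Sum>\<gamma> | length \<gamma> \<le> N. (cmod (g i \<gamma>))\<^sup>2)"
proof -
  let ?W = "{\<alpha> :: 'n list. length \<alpha> \<le> N}"
  obtain e :: "'n list \<Rightarrow> 'h" where e: "orthonormal_on ?W e"
    using orthonormal_on_exists[OF inf finite_words_length_le] by blast
  define h where "h i = (\<Sum>\<gamma>\<in>?W. g i \<gamma> *\<^sub>C e \<gamma>)" for i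
  have nh: "(norm (h i))\<^sup>2 = (\<Sum>\<gamma>\<in>?W. (cmod (g i \<gamma>))\<^sup>2)" for i
    unfolding h_def by (rule norm_sum_orthonormal[OF e]) simp
  have ch: "cinner (h i) (e \<gamma>) = g i \<gamma>" if "\<gamma> \<in> ?W" for i \<gamma>
  proof -
    have "cinner (h i) (e \<gamma>) = (\<Sum>\<beta>\<in>?W. if \<beta> = \<gamma> then g i \<beta> else 0)"
      unfolding h_def cinner_sum_left cinner_scaleC_left
      using that by (intro sum.cong refl) (auto simp: orthonormal_onD[OF e])
    then show ?thesis using that by simp
  qed
  \<comment> \<open>\<open>L r \<gamma>\<close> is the component along \<open>e \<gamma>\<close> of
    the row \<open>\<phi>\<close> at the shift of weight \<open>r\<close>, applied to the column
    \<open>h\<close>. It is a polynomial in \<open>r\<close>, and at \<open>r = 1\<close> it is the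
    sum of the convolutions.\<close>
  define L where "L r \<gamma> = (\<Sum>i\<in>UNIV. \<Sum>k\<le>length \<gamma>.
      complex_of_real r ^ k * c i (take k \<gamma>) * g i (drop k \<gamma>))" for r \<gamma>
  have bound: "(\<Sum>\<gamma>\<in>?W. (cmod (L r \<gamma>))\<^sup>2) \<le> (\<Sum>i\<in>UNIV. \<Sum>\<gamma>\<in>?W. (cmod (g i \<gamma>))\<^sup>2)"
    if r: "0 \<le> r" "r < 1" for r
  proof -
    let ?S = "trunc_shift r N e"
    have "?S \<in> row_ball"
      using row_norm_trunc_shift[OF e r(1)] r(2) by (simp add: row_ball_iff trunc_shift_BH)
    then have B: "\<phi> ?S \<in> row_ball" by (rule \<phi>)
    define y where "y = (\<Sum>i\<in>UNIV. blinfun_apply (\<phi> ?S i) (h i))"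
    have "L r \<gamma> = cinner y (e \<gamma>)" if "\<gamma> \<in> ?W" for \<gamma>
      using that unfolding L_def y_def cinner_sum_left
      by (simp add: cinner_free_series_trunc_shift[OF c e r] ch)
    then have "(\<Sum>\<gamma>\<in>?W. (cmod (L r \<gamma>))\<^sup>2) = (\<Sum>\<gamma>\<in>?W. (cmod (cinner y (e \<gamma>)))\<^sup>2)" by simp
    also have "\<dots> \<le> (norm y)\<^sup>2" by (rule bessel_inequality[OF e]) simp
    also have "\<dots> \<le> (row_norm (\<phi> ?S))\<^sup>2 * (\<Sum>i\<in>UNIV. (norm (h i))\<^sup>2)"
      unfolding y_def using B by (intro row_norm_bound) (simp add: row_ball_iff)
    also have "\<dots> \<le> 1 * (\<Sum>i\<in>UNIV. (norm (h i))\<^sup>2)"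
      using B row_norm_nonneg[of "\<phi> ?S"]
      by (intro mult_right_mono sum_nonneg) (auto simp: row_ball_iff abs_square_le_1)
    finally show ?thesis by (simp add: nh)
  qed
  have "((\<lambda>r. \<Sum>\<gamma>\<in>?W. (cmod (L r \<gamma>))\<^sup>2) \<longlongrightarrow> (\<Sum>\<gamma>\<in>?W. (cmod (L 1 \<gamma>))\<^sup>2)) (at_left 1)"
    unfolding L_def by (intro tendsto_intros)
  moreover have "eventually (\<lambda>r. (\<Sum>\<gamma>\<in>?W. (cmod (L r \<gamma>))\<^sup>2) \<le> (\<Sum>i\<in>UNIV. \<Sum>\<gamma>\<in>?W. (cmod (g i \<gamma>))\<^sup>2))
      (at_left (1::real))"
    using bound by (intro eventually_mono[OF eventually_at_left_real[of 0 1]]) auto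
  ultimately have "(\<Sum>\<gamma>\<in>?W. (cmod (L 1 \<gamma>))\<^sup>2) \<le> (\<Sum>i\<in>UNIV. \<Sum>\<gamma>\<in>?W. (cmod (g i \<gamma>))\<^sup>2)"
    by (rule tendsto_upperbound) simp
  then show ?thesis by (simp add: L_def word_conv_def)
qed

text \<open>When the \<open>c i\<close> have no constant term, this gives the coefficients of the
  composition of the part of \<open>a\<close> of degree at most \<open>N\<close> with the series
  \<open>c i\<close>. The recursion follows the decomposition of a series into its constant and the
  parts beginning with each letter.\<close>

primrec comp_coeff ::
  "('n::finite \<Rightarrow> 'n list \<Rightarrow> complex) \<Rightarrow> nat \<Rightarrow> ('n list \<Rightarrow> complex) \<Rightarrow> 'n list \<Rightarrow> complex" where
  "comp_coeff c 0 a = (\<lambda>\<gamma>. if \<gamma> = [] then a [] else 0)"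
| "comp_coeff c (Suc N) a = (\<lambda>\<gamma>. if \<gamma> = [] then a []
     else \<Sum>i\<in>UNIV. word_conv (c i) (comp_coeff c N (\<lambda>\<alpha>. a (i # \<alpha>))) \<gamma>)"

text \<open>The term with \<open>k = 0\<close> drops out because \<open>c [] = 0\<close>, and every
  other term evaluates \<open>g\<close> at a strictly shorter word.\<close>

lemma word_conv_cong:
  assumes "c [] = 0" and "\<And>\<delta>. length \<delta> < length \<gamma> \<Longrightarrow> g \<delta> = g' \<delta>"
  shows "word_conv c g \<gamma> = word_conv c g' \<gamma>"
  unfolding word_conv_def
proof (rule sum.cong[OF refl])
  fix k assume "k \<in> {..length \<gamma>}"
  then show "c (take k \<gamma>) * g (drop k \<gamma>) = c (take k \<gamma>) * g' (drop k \<gamma>)"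
    using assms by (cases "k = 0 \<or> \<gamma> = []") auto
qed

text \<open>Without constant terms in \<open>c\<close>, a product of \<open>m\<close> factors
  contributes only to words of length at least \<open>m\<close>. Terms of \<open>a\<close> beyond
  degree \<open>N\<close> therefore leave the coefficients up to length \<open>N\<close>
  unchanged.\<close>

lemma comp_coeff_Suc_stable:
  assumes "\<And>i. c i [] = 0" and "length \<gamma> \<le> N"
  shows "comp_coeff c (Suc N) a \<gamma> = comp_coeff c N a \<gamma>"
  using assms(2)
proof (induction N arbitrary: a \<gamma>)
  case (Suc N)
  have "word_conv (c i) (comp_coeff c (Suc N) (\<lambda>\<alpha>. a (i # \<alpha>))) \<gamma> =
      word_conv (c i) (comp_coeff c N (\<lambda>\<alpha>. a (i # \<alpha>))) \<gamma>" for i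
    using Suc.prems by (intro word_conv_cong assms(1) Suc.IH) auto
  then show ?case by (simp del: comp_coeff.simps add: comp_coeff.simps(2)[of c "Suc N"] comp_coeff.simps(2)[of c N])
qed simp

lemma comp_coeff_stable:
  assumes "\<And>i. c i [] = 0" and "length \<gamma> \<le> N" and "N \<le> M"
  shows "comp_coeff c M a \<gamma> = comp_coeff c N a \<gamma>"
  using assms(3)
proof (induction M rule: dec_induct)
  case (step M)
  then show ?case using comp_coeff_Suc_stable[where c = c, OF assms(1), of \<gamma> M a] assms(2) by simp
qed simp

lemma comp_coeff_l2_le:
  fixes c :: "'n::finite \<Rightarrow> 'n list \<Rightarrow> complex"
  assumes contr: "\<And>g M. (\<Sum>\<gamma> | length \<gamma> \<le> M. (cmod (\<Sum>i\<in>UNIV. word_conv (c i) (g i) \<gamma>))\<^sup>2)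
      \<le> (\<Sum>i\<in>UNIV. \<Sum>\<gamma> | length \<gamma> \<le> M. (cmod (g i \<gamma>))\<^sup>2)"
    and c0: "\<And>i. c i [] = 0"
  shows "(\<Sum>\<gamma> | length \<gamma> \<le> M. (cmod (comp_coeff c N a \<gamma>))\<^sup>2) \<le> (\<Sum>\<alpha> | length \<alpha> \<le> N. (cmod (a \<alpha>))\<^sup>2)"
proof (induction N arbitrary: a)
  case 0
  have "(\<Sum>\<gamma> | length \<gamma> \<le> M. (cmod (comp_coeff c 0 a \<gamma>))\<^sup>2) =
      (\<Sum>\<gamma> :: 'n list | length \<gamma> \<le> M. if \<gamma> = [] then (cmod (a []))\<^sup>2 else 0)"
    by (intro sum.cong) auto
  then show ?case by simp
next
  case (Suc N)
  let ?W = "{\<gamma> :: 'n list. length \<gamma> \<le> M}"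
  let ?w = "\<lambda>\<gamma>. \<Sum>i\<in>UNIV. word_conv (c i) (comp_coeff c N (\<lambda>\<alpha>. a (i # \<alpha>))) \<gamma>"
  \<comment> \<open>The convolutions vanish at the empty word, so the constant and the remainder
    have disjoint supports and no cross term arises. This is the orthogonality in Littlewood's
    argument.\<close>
  have "(\<Sum>\<gamma>\<in>?W. (cmod (comp_coeff c (Suc N) a \<gamma>))\<^sup>2) =
      (\<Sum>\<gamma>\<in>?W. (if \<gamma> = [] then (cmod (a []))\<^sup>2 else 0) + (cmod (?w \<gamma>))\<^sup>2)"
    by (intro sum.cong) (auto simp: word_conv_def c0)
  also have "\<dots> = (cmod (a []))\<^sup>2 + (\<Sum>\<gamma>\<in>?W. (cmod (?w \<gamma>))\<^sup>2)"
    by (simp add: sum.distrib)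
  also have "\<dots> \<le> (cmod (a []))\<^sup>2 +
      (\<Sum>i\<in>UNIV. \<Sum>\<gamma>\<in>?W. (cmod (comp_coeff c N (\<lambda>\<alpha>. a (i # \<alpha>)) \<gamma>))\<^sup>2)"
    by (intro add_left_mono contr)
  also have "\<dots> \<le> (cmod (a []))\<^sup>2 + (\<Sum>i\<in>UNIV. \<Sum>\<alpha> | length \<alpha> \<le> N. (cmod (a (i # \<alpha>)))\<^sup>2)"
    by (intro add_left_mono sum_mono Suc.IH)
  also have "\<dots> = (\<Sum>\<alpha> | length \<alpha> \<le> Suc N. (cmod (a \<alpha>))\<^sup>2)"
    by (simp add: sum_words_le_Suc)
  finally show ?case .
qed

section \<open>Convergence of the composed series\<close>

text \<open>The row of all words of length \<open>k\<close> is the \<open>k\<close>-fold iterate of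
  the row \<open>X\<close>: factoring out first letters costs one factor \<open>row_norm X\<close>
  each time.\<close>

lemma norm_sum_op_word_le:
  fixes X :: "'n::finite \<Rightarrow> ('h::chilbert_space \<Rightarrow>\<^sub>L 'h)"
  assumes X: "\<And>i. X i \<in> BH"
  shows "(norm (\<Sum>\<alpha> | length \<alpha> = k. blinfun_apply (op_word X \<alpha>) (h \<alpha>)))\<^sup>2
    \<le> (row_norm X ^ k)\<^sup>2 * (\<Sum>\<alpha> | length \<alpha> = k. (norm (h \<alpha>))\<^sup>2)"
proof (induction k arbitrary: h)
  case 0
  then show ?case by (simp add: op_word_def)
next
  case (Suc k)
  let ?v = "\<lambda>i. \<Sum>\<alpha> | length \<alpha> = k. blinfun_apply (op_word X \<alpha>) (h (i # \<alpha>))"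
  have "(\<Sum>\<alpha> | length \<alpha> = Suc k. blinfun_apply (op_word X \<alpha>) (h \<alpha>)) =
      (\<Sum>i\<in>UNIV. blinfun_apply (X i) (?v i))"
    by (simp add: sum_words_Suc op_word_def blinfun.sum_right)
  then have "(norm (\<Sum>\<alpha> | length \<alpha> = Suc k. blinfun_apply (op_word X \<alpha>) (h \<alpha>)))\<^sup>2
      \<le> (row_norm X)\<^sup>2 * (\<Sum>i\<in>UNIV. (norm (?v i))\<^sup>2)"
    using row_norm_bound[where X = X and h = ?v, OF X] by simp
  also have "\<dots> \<le> (row_norm X)\<^sup>2 *
      (\<Sum>i\<in>UNIV. (row_norm X ^ k)\<^sup>2 * (\<Sum>\<alpha> | length \<alpha> = k. (norm (h (i # \<alpha>)))\<^sup>2))"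
    by (intro mult_left_mono sum_mono Suc.IH) auto
  also have "\<dots> = (row_norm X ^ Suc k)\<^sup>2 * (\<Sum>\<alpha> | length \<alpha> = Suc k. (norm (h \<alpha>))\<^sup>2)"
    by (simp add: sum_words_Suc sum_distrib_left[symmetric] power_mult_distrib mult.assoc)
  finally show ?case .
qed

text \<open>By complex linearity the scalars can be moved into the vector, which makes this the
  bound for word rows on the column of the \<open>a \<alpha> *\<^sub>C x\<close>.\<close>

lemma norm_hom_part_le:
  fixes X :: "'n::finite \<Rightarrow> ('h::chilbert_space \<Rightarrow>\<^sub>L 'h)"
  assumes X: "\<And>i. X i \<in> BH"
  shows "norm (hom_part X a k) \<le> row_norm X ^ k * sqrt (\<Sum>\<alpha> | length \<alpha> = k. (cmod (a \<alpha>))\<^sup>2)"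
proof (rule norm_blinfun_bound)
  fix x
  have "blinfun_apply (hom_part X a k) x =
      (\<Sum>\<alpha> | length \<alpha> = k. blinfun_apply (op_word X \<alpha>) (a \<alpha> *\<^sub>C x))"
    using op_word_BH[of X] X by (simp add: hom_part_apply BH_def)
  then have "(norm (blinfun_apply (hom_part X a k) x))\<^sup>2
      \<le> (row_norm X ^ k)\<^sup>2 * (\<Sum>\<alpha> | length \<alpha> = k. (norm (a \<alpha> *\<^sub>C x))\<^sup>2)"
    using norm_sum_op_word_le[where X = X and k = k and h = "\<lambda>\<alpha>. a \<alpha> *\<^sub>C x", OF X] by simp
  also have "\<dots> = (row_norm X ^ k * sqrt (\<Sum>\<alpha> | length \<alpha> = k. (cmod (a \<alpha>))\<^sup>2) * norm x)\<^sup>2"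
    by (simp add: norm_scaleC power_mult_distrib sum_distrib_right sum_nonneg)
  finally show "norm (blinfun_apply (hom_part X a k) x) \<le>
      row_norm X ^ k * sqrt (\<Sum>\<alpha> | length \<alpha> = k. (cmod (a \<alpha>))\<^sup>2) * norm x"
    by (rule power2_le_imp_le) (simp add: row_norm_nonneg sum_nonneg)
qed (simp add: row_norm_nonneg sum_nonneg)

lemma norm_hom_part_le_l2:
  fixes X :: "'n::finite \<Rightarrow> ('h::chilbert_space \<Rightarrow>\<^sub>L 'h)"
  assumes X: "X \<in> row_ball"
    and a: "\<And>M. (\<Sum>\<alpha> | length \<alpha> \<le> M. (cmod (a \<alpha>))\<^sup>2) \<le> K"
  shows "norm (hom_part X a k) \<le> row_norm X ^ k * sqrt K"
proof -
  have "(\<Sum>\<alpha> | length \<alpha> = k. (cmod (a \<alpha>))\<^sup>2) \<le> (\<Sum>\<alpha> | length \<alpha> \<le> k. (cmod (a \<alpha>))\<^sup>2)"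
    by (intro sum_mono2) auto
  then have "sqrt (\<Sum>\<alpha> | length \<alpha> = k. (cmod (a \<alpha>))\<^sup>2) \<le> sqrt K"
    using a[of k] by simp
  then have "row_norm X ^ k * sqrt (\<Sum>\<alpha> | length \<alpha> = k. (cmod (a \<alpha>))\<^sup>2) \<le> row_norm X ^ k * sqrt K"
    by (intro mult_left_mono) (simp_all add: row_norm_nonneg)
  with norm_hom_part_le[of X a k] X show ?thesis by (simp add: row_ball_iff)
qed

lemma summable_norm_hom_part:
  fixes X :: "'n::finite \<Rightarrow> ('h::chilbert_space \<Rightarrow>\<^sub>L 'h)"
  assumes X: "X \<in> row_ball"
    and a: "\<And>M. (\<Sum>\<alpha> | length \<alpha> \<le> M. (cmod (a \<alpha>))\<^sup>2) \<le> K"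
  shows "summable (\<lambda>k. norm (hom_part X a k))"
proof (rule summable_comparison_test')
  show "summable (\<lambda>k. row_norm X ^ k * sqrt K)"
    using X row_norm_nonneg[of X] by (intro summable_mult2 summable_geometric) (simp add: row_ball_iff)
  show "norm (norm (hom_part X a k)) \<le> row_norm X ^ k * sqrt K" for k
    using norm_hom_part_le_l2[OF X a] by simp
qed

lemma hom_part_add: "hom_part X (\<lambda>\<gamma>. a \<gamma> + b \<gamma>) k = hom_part X a k + hom_part X b k"
  by (rule blinfun_eqI) (simp add: hom_part_apply blinfun.add_left scaleC_add_left sum.distrib)

lemma hom_part_sum: "hom_part X (\<lambda>\<gamma>. \<Sum>i\<in>I. a i \<gamma>) k = (\<Sum>i\<in>I. hom_part X (a i) k)"
proof (rule blinfun_eqI)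
  fix x
  show "blinfun_apply (hom_part X (\<lambda>\<gamma>. \<Sum>i\<in>I. a i \<gamma>) k) x = blinfun_apply (\<Sum>i\<in>I. hom_part X (a i) k) x"
    unfolding blinfun.sum_left hom_part_apply CV.scale_sum_left by (rule sum.swap)
qed

lemma hom_part_0: "hom_part X a 0 = scaleC_op (a []) id_blinfun"
  by (simp add: hom_part_def op_word_def)

lemma hom_part_Suc:
  assumes X: "\<And>i. X i \<in> BH"
  shows "hom_part X a (Suc k) = (\<Sum>i\<in>UNIV. X i o\<^sub>L hom_part X (\<lambda>\<alpha>. a (i # \<alpha>)) k)"
  using X by (intro blinfun_eqI)
    (simp add: hom_part_apply blinfun.sum_left blinfun.sum_right sum_words_Suc op_word_def BH_def)

lemma hom_part_const:
  "hom_part X (\<lambda>\<gamma>. if \<gamma> = [] then z else 0) k = (if k = 0 then scaleC_op z id_blinfun else 0)"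
proof (cases k)
  case (Suc j)
  then show ?thesis by (intro blinfun_eqI) (auto simp: hom_part_apply intro!: sum.neutral)
qed (simp add: hom_part_0)

lemma op_word_append: "op_word X (\<alpha> @ \<beta>) = op_word X \<alpha> o\<^sub>L op_word X \<beta>"
  by (induction \<alpha>) (auto simp: op_word_def intro!: blinfun_eqI)

text \<open>Cutting at position \<open>j\<close> is a bijection from words of length
  \<open>k\<close> to pairs of words of lengths \<open>j\<close> and \<open>k - j\<close>. Formal
  convolution thus becomes the Cauchy product of operator series.\<close>

lemma hom_part_word_conv:
  fixes X :: "'n::finite \<Rightarrow> ('h::chilbert_space \<Rightarrow>\<^sub>L 'h)"
  assumes X: "\<And>i. X i \<in> BH"
  shows "hom_part X (word_conv c g) k = (\<Sum>j\<le>k. hom_part X c j o\<^sub>L hom_part X g (k - j))"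
proof (rule blinfun_eqI)
  fix x
  have W: "blinfun_apply (op_word X \<alpha>) (z *\<^sub>C y) = z *\<^sub>C blinfun_apply (op_word X \<alpha>) y" for \<alpha> z y
    using op_word_BH[of X \<alpha>] X by (simp add: BH_def)
  have "blinfun_apply (hom_part X (word_conv c g) k) x =
      (\<Sum>\<gamma> | length \<gamma> = k. \<Sum>j\<le>k. (c (take j \<gamma>) * g (drop j \<gamma>)) *\<^sub>C blinfun_apply (op_word X \<gamma>) x)"
    by (simp add: hom_part_apply word_conv_def CV.scale_sum_left)
  also have "\<dots> = (\<Sum>j\<le>k. \<Sum>\<gamma> | length \<gamma> = k.
      (c (take j \<gamma>) * g (drop j \<gamma>)) *\<^sub>C blinfun_apply (op_word X \<gamma>) x)"
    by (rule sum.swap)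
  also have "\<dots> = (\<Sum>j\<le>k. blinfun_apply (hom_part X c j o\<^sub>L hom_part X g (k - j)) x)"
  proof (rule sum.cong[OF refl])
    fix j assume j: "j \<in> {..k}"
    have "(\<Sum>\<gamma> | length \<gamma> = k. (c (take j \<gamma>) * g (drop j \<gamma>)) *\<^sub>C blinfun_apply (op_word X \<gamma>) x) =
      (\<Sum>(\<alpha>, \<beta>) \<in> {\<alpha>. length \<alpha> = j} \<times> {\<beta>. length \<beta> = k - j}.
        (c \<alpha> * g \<beta>) *\<^sub>C blinfun_apply (op_word X (\<alpha> @ \<beta>)) x)"
      by (rule sum.reindex_bij_witness[where i = "\<lambda>(\<alpha>, \<beta>). \<alpha> @ \<beta>" and j = "\<lambda>\<gamma>. (take j \<gamma>, drop j \<gamma>)"])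
        (use j in auto)
    also have "\<dots> = blinfun_apply (hom_part X c j o\<^sub>L hom_part X g (k - j)) x"
      by (simp add: sum.cartesian_product[symmetric] hom_part_apply op_word_append
          blinfun.sum_right W CV.scale_sum_right scaleC_scaleC) (rule sum.swap)
    finally show "(\<Sum>\<gamma> | length \<gamma> = k. (c (take j \<gamma>) * g (drop j \<gamma>)) *\<^sub>C blinfun_apply (op_word X \<gamma>) x) =
        blinfun_apply (hom_part X c j o\<^sub>L hom_part X g (k - j)) x" .
  qed
  finally show "blinfun_apply (hom_part X (word_conv c g) k) x =
      blinfun_apply (\<Sum>j\<le>k. hom_part X c j o\<^sub>L hom_part X g (k - j)) x"
    by (simp add: blinfun.sum_left)
qed

text \<open>For polynomial \<open>a\<close>, formal composition agrees with substitution of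
  \<open>Y\<close>. The induction splits off the first letter; the Cauchy product applies because
  the square-sum bound on \<open>comp_coeff\<close> makes its series absolutely convergent on the
  ball.\<close>

lemma comp_coeff_sums:
  fixes X Y :: "'n::finite \<Rightarrow> ('h::chilbert_space \<Rightarrow>\<^sub>L 'h)"
  assumes X: "X \<in> row_ball" and Y: "\<And>i. Y i \<in> BH"
    and sums: "\<And>i. hom_part X (c i) sums Y i"
    and abs: "\<And>i. summable (\<lambda>k. norm (hom_part X (c i) k))"
    and contr: "\<And>g M. (\<Sum>\<gamma> | length \<gamma> \<le> M. (cmod (\<Sum>i\<in>UNIV. word_conv (c i) (g i) \<gamma>))\<^sup>2)
      \<le> (\<Sum>i\<in>UNIV. \<Sum>\<gamma> | length \<gamma> \<le> M. (cmod (g i \<gamma>))\<^sup>2)"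
    and c0: "\<And>i. c i [] = 0"
  shows "hom_part X (comp_coeff c N a) sums (\<Sum>j\<le>N. hom_part Y a j)"
proof (induction N arbitrary: a)
  case 0
  have "hom_part X (comp_coeff c 0 a) = (\<lambda>k. if k = 0 then scaleC_op (a []) id_blinfun else 0)"
    by (rule ext) (simp add: hom_part_const)
  then show ?case
    using sums_single[of 0 "\<lambda>_. scaleC_op (a []) id_blinfun"] by (simp add: hom_part_0)
next
  case (Suc N)
  let ?a = "\<lambda>i \<alpha>. a (i # \<alpha>)"
  have XB: "X i \<in> BH" for i using X by (simp add: row_ball_iff)
  \<comment> \<open>The constant may be added at every word, since the convolutions vanish at the
    empty one.\<close>
  have eq: "comp_coeff c (Suc N) a = (\<lambda>\<gamma>. (if \<gamma> = [] then a [] else 0) +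
      (\<Sum>i\<in>UNIV. word_conv (c i) (comp_coeff c N (?a i)) \<gamma>))"
    by (rule ext) (simp add: word_conv_def c0)
  have hom_eq: "hom_part X (comp_coeff c (Suc N) a) = (\<lambda>k. (if k = 0 then scaleC_op (a []) id_blinfun else 0) +
      (\<Sum>i\<in>UNIV. \<Sum>j\<le>k. hom_part X (c i) j o\<^sub>L hom_part X (comp_coeff c N (?a i)) (k - j)))"
    by (rule ext) (simp only: eq hom_part_add hom_part_sum hom_part_const hom_part_word_conv[of X, OF XB])
  have "(\<lambda>k. \<Sum>j\<le>k. hom_part X (c i) j o\<^sub>L hom_part X (comp_coeff c N (?a i)) (k - j)) sums
      (Y i o\<^sub>L (\<Sum>j\<le>N. hom_part Y (?a i) j))" for i
    by (intro bounded_bilinear.Cauchy_product_sums[OF bounded_bilinear_blinfun_compose] abs sums Suc.IH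
        summable_norm_hom_part[OF X comp_coeff_l2_le[OF contr c0]])
  then have "(\<lambda>k. (if k = 0 then scaleC_op (a []) id_blinfun else 0) +
      (\<Sum>i\<in>UNIV. \<Sum>j\<le>k. hom_part X (c i) j o\<^sub>L hom_part X (comp_coeff c N (?a i)) (k - j))) sums
      (scaleC_op (a []) id_blinfun + (\<Sum>i\<in>UNIV. Y i o\<^sub>L (\<Sum>j\<le>N. hom_part Y (?a i) j)))"
    by (intro sums_add sums_sum sums_single[of 0 "\<lambda>_. scaleC_op (a []) id_blinfun"])
  moreover have "scaleC_op (a []) id_blinfun + (\<Sum>i\<in>UNIV. Y i o\<^sub>L (\<Sum>j\<le>N. hom_part Y (?a i) j)) =
      (\<Sum>j\<le>Suc N. hom_part Y a j)"
    unfolding sum.atMost_Suc_shift hom_part_0 hom_part_Suc[of Y, OF Y]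
      bounded_bilinear.sum_right[OF bounded_bilinear_blinfun_compose]
    by (subst sum.swap) simp
  ultimately show ?case by (simp only: hom_eq)
qed

text \<open>The \<open>N\<close>-th partial sum of the diagonal series is that of the composition
  truncated at degree \<open>N\<close>, whose full sum is the \<open>N\<close>-th partial sum of the
  series in \<open>Y\<close>. The two differ by a tail that decays geometrically, with the constant
  \<open>K\<close> the same for every \<open>N\<close>.\<close>

lemma comp_coeff_diagonal_sums:
  fixes X Y :: "'n::finite \<Rightarrow> ('h::chilbert_space \<Rightarrow>\<^sub>L 'h)"
  assumes X: "X \<in> row_ball" and Y: "\<And>i. Y i \<in> BH"
    and sums: "\<And>i. hom_part X (c i) sums Y i"
    and abs: "\<And>i. summable (\<lambda>k. norm (hom_part X (c i) k))"
    and contr: "\<And>g M. (\<Sum>\<gamma> | length \<gamma> \<le> M. (cmod (\<Sum>i\<in>UNIV. word_conv (c i) (g i) \<gamma>))\<^sup>2)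
      \<le> (\<Sum>i\<in>UNIV. \<Sum>\<gamma> | length \<gamma> \<le> M. (cmod (g i \<gamma>))\<^sup>2)"
    and c0: "\<And>i. c i [] = 0"
    and a: "\<And>N. (\<Sum>\<alpha> | length \<alpha> \<le> N. (cmod (a \<alpha>))\<^sup>2) \<le> K"
    and F: "hom_part Y a sums F"
  shows "hom_part X (\<lambda>\<gamma>. comp_coeff c (length \<gamma>) a \<gamma>) sums F"
proof -
  let ?b = "\<lambda>\<gamma>. comp_coeff c (length \<gamma>) a \<gamma>"
  let ?\<rho> = "row_norm X"
  have \<rho>: "0 \<le> ?\<rho>" "?\<rho> < 1" using X by (auto simp: row_ball_iff row_norm_nonneg)
  have l2: "(\<Sum>\<gamma> | length \<gamma> \<le> M. (cmod (comp_coeff c N a \<gamma>))\<^sup>2) \<le> K" for M N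
    using comp_coeff_l2_le[where c = c and M = M and N = N and a = a, OF contr c0] a[of N] by linarith
  have stable: "?b \<gamma> = comp_coeff c N a \<gamma>" if "length \<gamma> \<le> N" for \<gamma> N
    by (rule comp_coeff_stable[where c = c, OF c0 order_refl that, symmetric])
  have partial: "(\<Sum>k\<le>N. hom_part X ?b k) = (\<Sum>k\<le>N. hom_part X (comp_coeff c N a) k)" for N
    unfolding hom_part_def
  proof (intro sum.cong refl)
    fix k and \<gamma> :: "'n list"
    assume "k \<in> {..N}" "\<gamma> \<in> {\<gamma>. length \<gamma> = k}"
    then show "scaleC_op (?b \<gamma>) (op_word X \<gamma>) = scaleC_op (comp_coeff c N a \<gamma>) (op_word X \<gamma>)"
      using stable[of \<gamma> N] by simp
  qed
  have tail: "norm ((\<Sum>k\<le>N. hom_part X ?b k) - (\<Sum>j\<le>N. hom_part Y a j)) \<le>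
      ?\<rho> ^ Suc N * (sqrt K / (1 - ?\<rho>))" for N
  proof -
    let ?h = "hom_part X (comp_coeff c N a)"
    have s: "?h sums (\<Sum>j\<le>N. hom_part Y a j)"
      by (rule comp_coeff_sums[OF X Y sums abs contr c0])
    have n: "summable (\<lambda>k. norm (?h k))" by (rule summable_norm_hom_part[OF X l2])
    then have n': "summable (\<lambda>k. norm (?h (k + Suc N)))" by (subst summable_iff_shift)
    \<comment> \<open>This majorizes the tail: the part of degree \<open>k + Suc N\<close> has norm
      at most \<open>row_norm X ^ (k + Suc N) * sqrt K\<close>.\<close>
    have g: "(\<lambda>k. ?\<rho> ^ Suc N * sqrt K * ?\<rho> ^ k) sums (?\<rho> ^ Suc N * sqrt K * (1 / (1 - ?\<rho>)))"
      using \<rho> by (intro sums_mult geometric_sums) simp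
    have "(\<lambda>k. ?h (k + Suc N)) sums ((\<Sum>j\<le>N. hom_part Y a j) - (\<Sum>k\<le>N. ?h k))"
      using sums_split_initial_segment[OF s, of "Suc N"] by (simp only: lessThan_Suc_atMost)
    then have "norm ((\<Sum>j\<le>N. hom_part Y a j) - (\<Sum>k\<le>N. ?h k)) \<le> (\<Sum>k. norm (?h (k + Suc N)))"
      using summable_norm[OF n'] by (simp add: sums_iff)
    also have "\<dots> \<le> ?\<rho> ^ Suc N * sqrt K * (1 / (1 - ?\<rho>))"
    proof (rule sums_le[OF _ summable_sums[OF n'] g])
      fix k
      show "norm (?h (k + Suc N)) \<le> ?\<rho> ^ Suc N * sqrt K * ?\<rho> ^ k"
        using norm_hom_part_le_l2[where a = "comp_coeff c N a" and k = "k + Suc N", OF X l2] by (simp add: power_add ac_simps)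
    qed
    finally show ?thesis unfolding partial by (simp add: norm_minus_commute)
  qed
  have "(\<lambda>N. ?\<rho> ^ Suc N * (sqrt K / (1 - ?\<rho>))) \<longlonglongrightarrow> 0"
    using \<rho> by (intro tendsto_mult_left_zero LIMSEQ_Suc LIMSEQ_power_zero) simp
  with always_eventually[OF allI[OF tail]]
  have "(\<lambda>N. (\<Sum>k\<le>N. hom_part X ?b k) - (\<Sum>j\<le>N. hom_part Y a j)) \<longlonglongrightarrow> 0"
    by (rule Lim_null_comparison)
  moreover have "(\<lambda>N. \<Sum>j\<le>N. hom_part Y a j) \<longlonglongrightarrow> F"
    using F by (simp add: sums_def_le)
  ultimately have "(\<lambda>N. (\<Sum>k\<le>N. hom_part X ?b k) - (\<Sum>j\<le>N. hom_part Y a j) + (\<Sum>j\<le>N. hom_part Y a j))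
      \<longlonglongrightarrow> 0 + F"
    by (rule tendsto_add)
  then show ?thesis by (simp add: sums_def_le)
qed

section \<open>Coefficient bounds and the norm inequality for the composition\<close>

lemma limsup_l2_root_le_1:
  fixes b :: "'n::finite list \<Rightarrow> complex"
  assumes b: "\<And>N. (\<Sum>\<alpha> | length \<alpha> \<le> N. (cmod (b \<alpha>))\<^sup>2) \<le> K"
  shows "limsup (\<lambda>k. ereal ((\<Sum>\<alpha> | length \<alpha> = k. (cmod (b \<alpha>))\<^sup>2) powr (1 / (2 * real k)))) \<le> 1"
proof -
  \<comment> \<open>A nonzero base is needed for its powers with exponents tending to 0 to converge
    to 1.\<close>
  let ?K = "max 1 K"
  have K1: "?K \<ge> 1" by simp
  then have K0: "?K \<noteq> 0" by linarith
  have "(\<lambda>k. 1 / (2 * real k)) \<longlonglongrightarrow> 0"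
    using tendsto_mult_right_zero[OF lim_inverse_n, of "1/2"] by (simp add: field_simps)
  then have "(\<lambda>k. ?K powr (1 / (2 * real k))) \<longlonglongrightarrow> ?K powr 0"
    using K0 by (intro tendsto_powr tendsto_const)
  then have lim: "(\<lambda>k. ereal (?K powr (1 / (2 * real k)))) \<longlonglongrightarrow> 1"
    using K0 by (simp add: one_ereal_def)
  have "limsup (\<lambda>k. ereal ((\<Sum>\<alpha> | length \<alpha> = k. (cmod (b \<alpha>))\<^sup>2) powr (1 / (2 * real k))))
      \<le> limsup (\<lambda>k. ereal (?K powr (1 / (2 * real k))))"
  proof (intro Limsup_mono always_eventually allI)
    fix k
    have "(\<Sum>\<alpha> | length \<alpha> = k. (cmod (b \<alpha>))\<^sup>2) \<le> (\<Sum>\<alpha> | length \<alpha> \<le> k. (cmod (b \<alpha>))\<^sup>2)"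
      by (intro sum_mono2) auto
    also have "\<dots> \<le> ?K" using b[of k] by simp
    finally show "ereal ((\<Sum>\<alpha> | length \<alpha> = k. (cmod (b \<alpha>))\<^sup>2) powr (1 / (2 * real k)))
        \<le> ereal (?K powr (1 / (2 * real k)))"
      by (simp add: powr_mono2 sum_nonneg)
  qed
  also have "\<dots> = 1" using lim by (intro lim_imp_Limsup) auto
  finally show ?thesis .
qed

lemma word_conv_unit: "word_conv c (\<lambda>\<gamma>. if \<gamma> = [] then 1 else 0) = c"
proof
  fix \<gamma>
  have "word_conv c (\<lambda>\<gamma>. if \<gamma> = [] then 1 else 0) \<gamma> = (\<Sum>k\<le>length \<gamma>. if k = length \<gamma> then c \<gamma> else 0)"
    unfolding word_conv_def by (intro sum.cong) auto
  then show "word_conv c (\<lambda>\<gamma>. if \<gamma> = [] then 1 else 0) \<gamma> = c \<gamma>" by simp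
qed

text \<open>Apply the contraction to the column with the convolution unit in slot \<open>i\<close>
  and zero elsewhere. The bound provides absolute convergence of the coordinate series of the
  self-map.\<close>

lemma row_contraction_coeff_l2:
  fixes c :: "'n::finite \<Rightarrow> 'n list \<Rightarrow> complex"
  assumes contr: "\<And>g M. (\<Sum>\<gamma> | length \<gamma> \<le> M. (cmod (\<Sum>i\<in>UNIV. word_conv (c i) (g i) \<gamma>))\<^sup>2)
      \<le> (\<Sum>i\<in>UNIV. \<Sum>\<gamma> | length \<gamma> \<le> M. (cmod (g i \<gamma>))\<^sup>2)"
  shows "(\<Sum>\<gamma> | length \<gamma> \<le> M. (cmod (c i \<gamma>))\<^sup>2) \<le> 1"
proof -
  define u :: "'n list \<Rightarrow> complex" where "u = (\<lambda>\<gamma>. if \<gamma> = [] then 1 else 0)"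
  have "(\<Sum>\<gamma> | length \<gamma> \<le> M. (cmod (u \<gamma>))\<^sup>2) = (\<Sum>\<gamma> :: 'n list | length \<gamma> \<le> M. if \<gamma> = [] then 1 else 0)"
    by (intro sum.cong) (auto simp: u_def)
  then have u1: "(\<Sum>\<gamma> | length \<gamma> \<le> M. (cmod (u \<gamma>))\<^sup>2) = 1" by simp
  define g where "g = (\<lambda>j. if j = i then u else (\<lambda>_. 0))"
  have "word_conv (c j) (g j) \<gamma> = (if j = i then c i \<gamma> else 0)" for j \<gamma>
    by (cases "j = i") (simp_all add: g_def u_def word_conv_unit, simp add: word_conv_def)
  then have "(\<Sum>\<gamma> | length \<gamma> \<le> M. (cmod (c i \<gamma>))\<^sup>2) =
      (\<Sum>\<gamma> | length \<gamma> \<le> M. (cmod (\<Sum>j\<in>UNIV. word_conv (c j) (g j) \<gamma>))\<^sup>2)" by simp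
  also have "\<dots> \<le> (\<Sum>j\<in>UNIV. \<Sum>\<gamma> | length \<gamma> \<le> M. (cmod (g j \<gamma>))\<^sup>2)" by (rule contr)
  also have "\<dots> = (\<Sum>j\<in>UNIV. if j = i then (\<Sum>\<gamma> | length \<gamma> \<le> M. (cmod (u \<gamma>))\<^sup>2) else 0)"
    by (intro sum.cong refl) (auto simp: g_def)
  finally show ?thesis by (simp add: u1)
qed

text \<open>With weight 0 and truncation 0 the shift is the zero tuple, so the coefficient formula
  at the empty word evaluates \<open>f\<close> at the origin.\<close>

lemma free_series_constant_term:
  fixes f :: "('n::finite \<Rightarrow> ('h::chilbert_space \<Rightarrow>\<^sub>L 'h)) \<Rightarrow> ('h \<Rightarrow>\<^sub>L 'h)"
  assumes inf: "\<nexists>B :: 'h set. finite B \<and> module.span scaleC B = UNIV"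
    and f: "has_free_series f a" and f0: "f (\<lambda>i. 0) = 0"
  shows "a [] = 0"
proof -
  obtain e :: "'n list \<Rightarrow> 'h" where e: "orthonormal_on {\<alpha>. length \<alpha> \<le> 0} e"
    using orthonormal_on_exists[OF inf finite_words_length_le] by blast
  have "trunc_shift 0 0 e = (\<lambda>i. 0)"
    by (intro ext blinfun_eqI) (simp add: trunc_shift_apply)
  then have "0 = a [] * cinner (e []) (e [])"
    using cinner_free_series_trunc_shift[OF f e order_refl, of "[]" "e []"] f0 by simp
  then show ?thesis by (simp add: orthonormal_onD[OF e])
qed

lemma finite_words_subset_length_le:
  assumes "finite (A :: 'n list set)"
  obtains N where "A \<subseteq> {\<alpha>. length \<alpha> \<le> N}"
  using assms by (intro that[of "Max (length ` A)"]) auto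

theorem theorem1p2:
  fixes \<phi> :: "('n::finite \<Rightarrow> ('h::chilbert_space \<Rightarrow>\<^sub>L 'h)) \<Rightarrow> ('n \<Rightarrow> ('h \<Rightarrow>\<^sub>L 'h))"
    and f :: "('n \<Rightarrow> ('h \<Rightarrow>\<^sub>L 'h)) \<Rightarrow> ('h \<Rightarrow>\<^sub>L 'h)"
  assumes separable: "separable_space (euclidean :: 'h topology)"
    and infinite_dim: "\<nexists>B :: 'h set. finite B \<and> module.span scaleC B = UNIV"
    and self_map: "free_self_map \<phi>"
    and zero: "\<phi> (\<lambda>i. 0) = (\<lambda>i. 0)"
    and f: "f \<in> H2_ball"
  shows "f \<circ> \<phi> \<in> H2_ball \<and> H2_norm (f \<circ> \<phi>) \<le> H2_norm f"
proof -
  obtain a where fa: "has_free_series f a"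
    using f by (auto simp: H2_ball_def free_holomorphic_def)
  have ca: "free_coeff f = a" by (rule free_coeff_eqI[OF infinite_dim fa])
  have sa: "(\<lambda>\<alpha>. (cmod (a \<alpha>))\<^sup>2) summable_on UNIV" using f by (simp add: H2_ball_def ca)
  define K where "K = (\<Sum>\<^sub>\<infinity>\<alpha>. (cmod (a \<alpha>))\<^sup>2)"
  have aK: "(\<Sum>\<alpha> | length \<alpha> \<le> N. (cmod (a \<alpha>))\<^sup>2) \<le> K" for N
    unfolding K_def by (rule finite_sum_le_infsum[OF sa]) auto
  have "\<forall>i. \<exists>c. has_free_series (\<lambda>X. \<phi> X i) c"
    using self_map by (simp add: free_self_map_def free_holomorphic_def)
  then obtain c where c: "\<And>i. has_free_series (\<lambda>X. \<phi> X i) (c i)" by metis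
  have \<phi>: "\<phi> X \<in> row_ball" if "X \<in> row_ball" for X
    using self_map that by (simp add: free_self_map_def)
  have c0: "c i [] = 0" for i
    by (rule free_series_constant_term[OF infinite_dim c]) (simp add: zero)
  note contr = self_map_row_contraction[where \<phi> = \<phi> and c = c, OF infinite_dim \<phi> c]
  \<comment> \<open>Truncating at \<open>length \<gamma>\<close> already gives the final
    coefficient, since \<open>\<phi>\<close> has no constant term.\<close>
  define b where "b = (\<lambda>\<gamma>. comp_coeff c (length \<gamma>) a \<gamma>)"
  have bK: "(\<Sum>\<gamma> | length \<gamma> \<le> N. (cmod (b \<gamma>))\<^sup>2) \<le> K" for N
  proof -
    have "b \<gamma> = comp_coeff c N a \<gamma>" if "length \<gamma> \<le> N" for \<gamma>
      unfolding b_def by (rule comp_coeff_stable[where c = c, OF c0 order_refl that, symmetric])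
    then have "(\<Sum>\<gamma> | length \<gamma> \<le> N. (cmod (b \<gamma>))\<^sup>2) = (\<Sum>\<gamma> | length \<gamma> \<le> N. (cmod (comp_coeff c N a \<gamma>))\<^sup>2)"
      by simp
    also have "\<dots> \<le> (\<Sum>\<alpha> | length \<alpha> \<le> N. (cmod (a \<alpha>))\<^sup>2)"
      by (rule comp_coeff_l2_le[OF contr c0])
    finally show ?thesis using aK[of N] by linarith
  qed
  have "hom_part X b sums (f \<circ> \<phi>) X" if X: "X \<in> row_ball" for X
  proof -
    have "hom_part X b sums f (\<phi> X)"
      unfolding b_def
    proof (rule comp_coeff_diagonal_sums[OF X _ _ _ contr c0 aK])
      show "\<phi> X i \<in> BH" for i using \<phi>[OF X] by (simp add: row_ball_iff)
      show "hom_part X (c i) sums \<phi> X i" for i by (rule has_free_series_sums[OF c X])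
      show "summable (\<lambda>k. norm (hom_part X (c i) k))" for i
        by (rule summable_norm_hom_part[OF X row_contraction_coeff_l2[OF contr]])
      show "hom_part (\<phi> X) a sums f (\<phi> X)" by (rule has_free_series_sums[OF fa \<phi>[OF X]])
    qed
    then show ?thesis by simp
  qed
  then have fb: "has_free_series (f \<circ> \<phi>) b"
    unfolding has_free_series_def hom_part_def[abs_def] using limsup_l2_root_le_1[OF bK] by blast
  have cb: "free_coeff (f \<circ> \<phi>) = b" by (rule free_coeff_eqI[OF infinite_dim fb])
  \<comment> \<open>Every finite set of words lies in some length ball, so the uniform bound
    \<open>bK\<close> controls all finite sums and with them the infinite one.\<close>
  have finb: "(\<Sum>\<gamma>\<in>A. (cmod (b \<gamma>))\<^sup>2) \<le> K" if A: "finite A" for A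
  proof -
    obtain N where "A \<subseteq> {\<gamma>. length \<gamma> \<le> N}" using finite_words_subset_length_le[OF A] .
    then have "(\<Sum>\<gamma>\<in>A. (cmod (b \<gamma>))\<^sup>2) \<le> (\<Sum>\<gamma> | length \<gamma> \<le> N. (cmod (b \<gamma>))\<^sup>2)"
      by (intro sum_mono2) auto
    then show ?thesis using bK[of N] by linarith
  qed
  have sb: "(\<lambda>\<gamma>. (cmod (b \<gamma>))\<^sup>2) summable_on UNIV"
    using finb by (intro nonneg_bdd_above_summable_on bdd_aboveI2) auto
  have "(\<Sum>\<^sub>\<infinity>\<gamma>. (cmod (b \<gamma>))\<^sup>2) \<le> K"
    by (rule infsum_le_finite_sums[OF sb finb])
  then show ?thesis
    using fb sb by (auto simp: H2_ball_def free_holomorphic_def H2_norm_def ca cb K_def)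
qed

end
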